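(* Let $(M,\varphi,\xi,\eta,g)$ be a conformal Kenmotsu space form and let $\acute{M}$ be a CR-hypersurface of $M$ with unit normal vector field $N$ whose shape operator $A$ is recurrent. Suppose that the Lee vector field satisfies $\omega^{\sharp}=N$ along $\acute{M}$. Then $\acute{M}$ is totally umbilic.
   Context: An almost contact metric structure $(\varphi,\xi,\eta,g)$ on a $(2n+1)$-dimensional smooth manifold $M$ consists of a $(1,1)$-tensor field $\varphi$, a vector field $\xi$, a 1-form $\eta$ and a Riemannian metric $g$ with $\varphi^2=-\mathrm{Id}+\eta\otimes\xi$, $\eta(\xi)=1$, $\varphi\xi=0$, $\eta\circ\varphi=0$, $g(\varphi X,\varphi Y)=g(X,Y)-\eta(X)\eta(Y)$, $\eta(X)=g(X,\xi)$. It is a Kenmotsu structure if $(\nabla_X\varphi)Y=-g(X,\varphi Y)\xi-\eta(Y)\varphi X$, with $\nabla$ the Levi-Civita connection of $g$. $(M,\varphi,\xi,\eta,g)$ is a conformal Kenmotsu manifold if there is a positive smooth function $f:M\to\mathbb{R}$ (fixed throughout) such that $(\varphi,\ \tilde\xi=e^{-f/2}\xi,\ \tilde\eta=e^{f/2}\eta,\ \tilde g=e^{f}g)$ is a Kenmotsu structure on $M$. It is a conformal Kenmotsu space form if moreover this Kenmotsu structure has constant $\varphi$-holomorphic sectional curvature $c$, i.e. the $\tilde g$-sectional curvature of $\mathrm{span}\{X,\varphi X\}$ equals the constant $c$ for all nonzero $X$ orthogonal to $\tilde\xi$. The 1-form $\omega$ is $\omega(X)=X(f)$, and the Lee vector field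 is $\omega^{\sharp}=\mathrm{grad} f$ (gradient with respect to $g$). A CR-hypersurface of $M$ is a $2n$-dimensional embedded submanifold $\acute{M}$ such that $\xi$ is tangent to $\acute{M}$ and $T\acute{M}$ is an orthogonal direct sum of distributions $D\oplus D^{\perp}$ with $\varphi(D_p)\subset D_p$ and $\varphi(D^{\perp}_p)\subset T_p^{\perp}\acute{M}$ for all $p\in\acute M$. With $N$ a unit normal vector field of $\acute{M}$ and $U=-\varphi N$, one takes $D^{\perp}=\mathrm{span}\{U,\xi\}$ and $D$ its orthogonal complement in $T\acute{M}$. $\acute g$ is the induced metric, $\acute\nabla$ its Levi-Civita connection, and $A$ is the shape operator with respect to $N$: $AX=-\nabla_XN$, where $\nabla$ is the Levi-Civita connection of $g$. $A$ is recurrent if there exists a 1-form $\alpha$ on $\acute{M}$ such that $(\acute\nabla_XA)Y=\alpha(X)AY$ for all $X,Y$ tangent to $\acute{M}$. Totally umbilic means that $A=\mu\,\mathrm{Id}$ for some function $\mu$ on $\acute M$. *)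

theory Defs
  imports "HOL-Analysis.Analysis" "HOL-Library.Function_Algebras"
begin

text \<open>Tangent vectors act on real functions; the pointwise operations make them a vector space.\<close>

instantiation "fun" :: (type, scaleR) scaleR
begin
definition scaleR_fun_def: "r *\<^sub>R f = (\<lambda>x. r *\<^sub>R f x)"
instance ..
end

lemma scaleR_fun_apply [simp]: "(r *\<^sub>R f) x = r *\<^sub>R f x"
  by (simp add: scaleR_fun_def)

instance "fun" :: (type, real_vector) real_vector
  by standard (simp_all add: fun_eq_iff algebra_simps)

text \<open>For open \<open>S\<close> in a finite-dimensional space these are the usual classes
  \<open>C\<^sup>k\<close> and \<open>C\<^sup>\<infinity>\<close>: all directional derivatives are required to be \<open>C\<^sup>k\<close> again.\<close>

primrec Ck_on :: "nat \<Rightarrow> 'a::real_normed_vector set \<Rightarrow> ('a \<Rightarrow> 'b::real_normed_vector) \<Rightarrow> bool" where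
  "Ck_on 0 S f \<longleftrightarrow> continuous_on S f"
| "Ck_on (Suc k) S f \<longleftrightarrow> (\<forall>x\<in>S. f differentiable (at x)) \<and>
     (\<forall>v. Ck_on k S (\<lambda>x. frechet_derivative f (at x) v))"

definition smooth_on :: "'a::real_normed_vector set \<Rightarrow> ('a \<Rightarrow> 'b::real_normed_vector) \<Rightarrow> bool" where
  "smooth_on S f \<longleftrightarrow> (\<forall>k. Ck_on k S f)"

text \<open>A chart is a pair of a domain \<open>U\<close> and a coordinate map on it (its values outside \<open>U\<close> are
  irrelevant). The atlas need not be maximal.\<close>

record ('a, 'e) mfd =
  topo :: "'a topology"
  atlas :: "('a set \<times> ('a \<Rightarrow> 'e)) set"

definition points :: "('a, 'e) mfd \<Rightarrow> 'a set" where
  "points M = topspace (topo M)"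

definition smooth_manifold :: "nat \<Rightarrow> ('a, 'e::euclidean_space) mfd \<Rightarrow> bool" where
  "smooth_manifold m M \<longleftrightarrow>
     DIM('e) = m \<and>
     Hausdorff_space (topo M) \<and> second_countable (topo M) \<and>
     (\<Union>(U, \<kappa>)\<in>atlas M. U) = points M \<and>
     (\<forall>(U, \<kappa>)\<in>atlas M. openin (topo M) U \<and> open (\<kappa> ` U) \<and>
        homeomorphic_map (subtopology (topo M) U) (top_of_set (\<kappa> ` U)) \<kappa>) \<and>
     (\<forall>(U, \<kappa>)\<in>atlas M. \<forall>(V, \<psi>)\<in>atlas M. smooth_on (\<kappa> ` (U \<inter> V)) (\<psi> \<circ> inv_into U \<kappa>))"

definition smooth_fun :: "('a, 'e::euclidean_space) mfd \<Rightarrow> 'a set \<Rightarrow> ('a \<Rightarrow> real) \<Rightarrow> bool" where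
  "smooth_fun M W f \<longleftrightarrow> openin (topo M) W \<and>
     (\<forall>(U, \<kappa>)\<in>atlas M. smooth_on (\<kappa> ` (U \<inter> W)) (f \<circ> inv_into U \<kappa>))"

definition smooth_near :: "('a, 'e::euclidean_space) mfd \<Rightarrow> 'a \<Rightarrow> ('a \<Rightarrow> real) \<Rightarrow> bool" where
  "smooth_near M p f \<longleftrightarrow> (\<exists>W. p \<in> W \<and> smooth_fun M W f)"

type_synonym 'a tvec = "('a \<Rightarrow> real) \<Rightarrow> real"

text \<open>Tangent vectors at \<open>p\<close> are the directional derivatives at \<open>p\<close> in a chart, as operators on
  the functions that are smooth near \<open>p\<close>. They are extended by \<open>0\<close> to all other functions, so that
  equality of operators is equality of tangent vectors.\<close>

definition tangent_space :: "('a, 'e::euclidean_space) mfd \<Rightarrow> 'a \<Rightarrow> 'a tvec set" where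
  "tangent_space M p = {v. \<exists>(U, \<kappa>)\<in>atlas M. p \<in> U \<and> (\<exists>u. v = (\<lambda>f.
     if smooth_near M p f then frechet_derivative (f \<circ> inv_into U \<kappa>) (at (\<kappa> p)) u else 0))}"

text \<open>A vector field is smooth on the open set \<open>W\<close> if it maps smooth functions to smooth functions.
  Its values outside \<open>W\<close> are irrelevant.\<close>

definition smooth_vf :: "('a, 'e::euclidean_space) mfd \<Rightarrow> 'a set \<Rightarrow> ('a \<Rightarrow> 'a tvec) \<Rightarrow> bool" where
  "smooth_vf M W X \<longleftrightarrow> openin (topo M) W \<and> (\<forall>p\<in>W. X p \<in> tangent_space M p) \<and>
     (\<forall>V f. V \<subseteq> W \<longrightarrow> smooth_fun M V f \<longrightarrow> smooth_fun M V (\<lambda>p. X p f))"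

definition lie_bracket ::
  "('a, 'e::euclidean_space) mfd \<Rightarrow> ('a \<Rightarrow> 'a tvec) \<Rightarrow> ('a \<Rightarrow> 'a tvec) \<Rightarrow> 'a \<Rightarrow> 'a tvec" where
  "lie_bracket M X Y p = (\<lambda>f. if smooth_near M p f
     then X p (\<lambda>q. Y q f) - Y p (\<lambda>q. X q f) else 0)"

definition linear_map_on :: "'v::real_vector set \<Rightarrow> ('v \<Rightarrow> 'w::real_vector) \<Rightarrow> bool" where
  "linear_map_on V L \<longleftrightarrow> (\<forall>v\<in>V. \<forall>w\<in>V. L (v + w) = L v + L w) \<and> (\<forall>a. \<forall>v\<in>V. L (a *\<^sub>R v) = a *\<^sub>R L v)"

definition one_form :: "('a, 'e::euclidean_space) mfd \<Rightarrow> ('a \<Rightarrow> 'a tvec \<Rightarrow> real) \<Rightarrow> bool" where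
  "one_form M \<alpha> \<longleftrightarrow>
     (\<forall>p\<in>points M. linear_map_on (tangent_space M p) (\<alpha> p)) \<and>
     (\<forall>W X. smooth_vf M W X \<longrightarrow> smooth_fun M W (\<lambda>p. \<alpha> p (X p)))"

definition tensor11 :: "('a, 'e::euclidean_space) mfd \<Rightarrow> ('a \<Rightarrow> 'a tvec \<Rightarrow> 'a tvec) \<Rightarrow> bool" where
  "tensor11 M T \<longleftrightarrow>
     (\<forall>p\<in>points M. linear_map_on (tangent_space M p) (T p) \<and> T p ` tangent_space M p \<subseteq> tangent_space M p) \<and>
     (\<forall>W X. smooth_vf M W X \<longrightarrow> smooth_vf M W (\<lambda>p. T p (X p)))"

definition riemannian_metric ::
  "('a, 'e::euclidean_space) mfd \<Rightarrow> ('a \<Rightarrow> 'a tvec \<Rightarrow> 'a tvec \<Rightarrow> real) \<Rightarrow> bool" where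
  "riemannian_metric M g \<longleftrightarrow>
     (\<forall>p\<in>points M. \<forall>v\<in>tangent_space M p. linear_map_on (tangent_space M p) (g p v)) \<and>
     (\<forall>p\<in>points M. \<forall>v\<in>tangent_space M p. \<forall>w\<in>tangent_space M p. g p v w = g p w v) \<and>
     (\<forall>p\<in>points M. \<forall>v\<in>tangent_space M p. v \<noteq> 0 \<longrightarrow> g p v v > 0) \<and>
     (\<forall>W X Y. smooth_vf M W X \<longrightarrow> smooth_vf M W Y \<longrightarrow> smooth_fun M W (\<lambda>p. g p (X p) (Y p)))"

text \<open>\<open>nabla p v Y\<close> is the covariant derivative at \<open>p\<close>, in direction \<open>v \<in> T\<^sub>pM\<close>, of a vector field
  \<open>Y\<close> that is smooth on some open neighbourhood of \<open>p\<close>. It depends only on the germ of \<open>Y\<close>: apply the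
  Leibniz rule to the product of \<open>Y\<close> with the indicator function of a smaller neighbourhood of
  \<open>p\<close>, which is smooth near \<open>p\<close>.\<close>

type_synonym 'a connection = "'a \<Rightarrow> 'a tvec \<Rightarrow> ('a \<Rightarrow> 'a tvec) \<Rightarrow> 'a tvec"

definition affine_connection :: "('a, 'e::euclidean_space) mfd \<Rightarrow> 'a connection \<Rightarrow> bool" where
  "affine_connection M nabla \<longleftrightarrow>
     (\<forall>W Y. smooth_vf M W Y \<longrightarrow> (\<forall>p\<in>W.
        (\<forall>v\<in>tangent_space M p. nabla p v Y \<in> tangent_space M p) \<and>
        linear_map_on (tangent_space M p) (\<lambda>v. nabla p v Y))) \<and>
     (\<forall>W Y Z. smooth_vf M W Y \<longrightarrow> smooth_vf M W Z \<longrightarrow> (\<forall>p\<in>W. \<forall>v\<in>tangent_space M p.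
        nabla p v (\<lambda>q. Y q + Z q) = nabla p v Y + nabla p v Z)) \<and>
     (\<forall>W h Y. smooth_fun M W h \<longrightarrow> smooth_vf M W Y \<longrightarrow> (\<forall>p\<in>W. \<forall>v\<in>tangent_space M p.
        nabla p v (\<lambda>q. h q *\<^sub>R Y q) = v h *\<^sub>R Y p + h p *\<^sub>R nabla p v Y)) \<and>
     (\<forall>W X Y. smooth_vf M W X \<longrightarrow> smooth_vf M W Y \<longrightarrow> smooth_vf M W (\<lambda>p. nabla p (X p) Y))"

definition levi_civita ::
  "('a, 'e::euclidean_space) mfd \<Rightarrow> ('a \<Rightarrow> 'a tvec \<Rightarrow> 'a tvec \<Rightarrow> real) \<Rightarrow> 'a connection \<Rightarrow> bool" where
  "levi_civita M g nabla \<longleftrightarrow> affine_connection M nabla \<and>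
     (\<forall>W X Y. smooth_vf M W X \<longrightarrow> smooth_vf M W Y \<longrightarrow> (\<forall>p\<in>W.
        nabla p (X p) Y - nabla p (Y p) X = lie_bracket M X Y p)) \<and>
     (\<forall>W Y Z. smooth_vf M W Y \<longrightarrow> smooth_vf M W Z \<longrightarrow> (\<forall>p\<in>W. \<forall>v\<in>tangent_space M p.
        v (\<lambda>q. g q (Y q) (Z q)) = g p (nabla p v Y) (Z p) + g p (Y p) (nabla p v Z)))"

definition cov_deriv_tensor11 ::
  "'a connection \<Rightarrow> ('a \<Rightarrow> 'a tvec \<Rightarrow> 'a tvec) \<Rightarrow> 'a \<Rightarrow> 'a tvec \<Rightarrow> ('a \<Rightarrow> 'a tvec) \<Rightarrow> 'a tvec" where
  "cov_deriv_tensor11 nabla T p v Y = nabla p v (\<lambda>q. T q (Y q)) - T p (nabla p v Y)"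

definition curvature :: "('a, 'e::euclidean_space) mfd \<Rightarrow> 'a connection \<Rightarrow>
    ('a \<Rightarrow> 'a tvec) \<Rightarrow> ('a \<Rightarrow> 'a tvec) \<Rightarrow> ('a \<Rightarrow> 'a tvec) \<Rightarrow> 'a \<Rightarrow> 'a tvec" where
  "curvature M nabla X Y Z p =
     nabla p (X p) (\<lambda>q. nabla q (Y q) Z) - nabla p (Y p) (\<lambda>q. nabla q (X q) Z) - nabla p (lie_bracket M X Y p) Z"

text \<open>The plane spanned by the linearly independent vectors \<open>u, v \<in> T\<^sub>pM\<close> has sectional curvature \<open>k\<close>;
  the curvature tensor is evaluated through local extensions \<open>X, Y\<close> of \<open>u, v\<close>.\<close>

definition has_sectional_curvature :: "('a, 'e::euclidean_space) mfd \<Rightarrow>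
    ('a \<Rightarrow> 'a tvec \<Rightarrow> 'a tvec \<Rightarrow> real) \<Rightarrow> 'a connection \<Rightarrow> 'a \<Rightarrow> 'a tvec \<Rightarrow> 'a tvec \<Rightarrow> real \<Rightarrow> bool" where
  "has_sectional_curvature M g nabla p u v k \<longleftrightarrow>
     (\<forall>W X Y. p \<in> W \<longrightarrow> smooth_vf M W X \<longrightarrow> smooth_vf M W Y \<longrightarrow> X p = u \<longrightarrow> Y p = v \<longrightarrow>
        g p (curvature M nabla X Y Y p) u / (g p u u * g p v v - (g p u v)\<^sup>2) = k)"

definition almost_contact_metric :: "nat \<Rightarrow> ('a, 'e::euclidean_space) mfd \<Rightarrow>
    ('a \<Rightarrow> 'a tvec \<Rightarrow> 'a tvec) \<Rightarrow> ('a \<Rightarrow> 'a tvec) \<Rightarrow> ('a \<Rightarrow> 'a tvec \<Rightarrow> real) \<Rightarrow>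
    ('a \<Rightarrow> 'a tvec \<Rightarrow> 'a tvec \<Rightarrow> real) \<Rightarrow> bool" where
  "almost_contact_metric n M \<phi> \<xi> \<eta> g \<longleftrightarrow>
     smooth_manifold (2 * n + 1) M \<and>
     tensor11 M \<phi> \<and> smooth_vf M (points M) \<xi> \<and> one_form M \<eta> \<and> riemannian_metric M g \<and>
     (\<forall>p\<in>points M.
        \<eta> p (\<xi> p) = 1 \<and> \<phi> p (\<xi> p) = 0 \<and>
        (\<forall>v\<in>tangent_space M p.
           \<phi> p (\<phi> p v) = - v + \<eta> p v *\<^sub>R \<xi> p \<and> \<eta> p (\<phi> p v) = 0 \<and> \<eta> p v = g p v (\<xi> p) \<and>
           (\<forall>w\<in>tangent_space M p. g p (\<phi> p v) (\<phi> p w) = g p v w - \<eta> p v * \<eta> p w)))"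

definition kenmotsu :: "nat \<Rightarrow> ('a, 'e::euclidean_space) mfd \<Rightarrow>
    ('a \<Rightarrow> 'a tvec \<Rightarrow> 'a tvec) \<Rightarrow> ('a \<Rightarrow> 'a tvec) \<Rightarrow> ('a \<Rightarrow> 'a tvec \<Rightarrow> real) \<Rightarrow>
    ('a \<Rightarrow> 'a tvec \<Rightarrow> 'a tvec \<Rightarrow> real) \<Rightarrow> 'a connection \<Rightarrow> bool" where
  "kenmotsu n M \<phi> \<xi> \<eta> g nabla \<longleftrightarrow>
     almost_contact_metric n M \<phi> \<xi> \<eta> g \<and> levi_civita M g nabla \<and>
     (\<forall>W Y. smooth_vf M W Y \<longrightarrow> (\<forall>p\<in>W. \<forall>v\<in>tangent_space M p.
        cov_deriv_tensor11 nabla \<phi> p v Y = - (g p v (\<phi> p (Y p)) *\<^sub>R \<xi> p) - \<eta> p (Y p) *\<^sub>R \<phi> p v))"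

definition constant_holomorphic_curvature :: "('a, 'e::euclidean_space) mfd \<Rightarrow>
    ('a \<Rightarrow> 'a tvec \<Rightarrow> 'a tvec) \<Rightarrow> ('a \<Rightarrow> 'a tvec) \<Rightarrow>
    ('a \<Rightarrow> 'a tvec \<Rightarrow> 'a tvec \<Rightarrow> real) \<Rightarrow> 'a connection \<Rightarrow> real \<Rightarrow> bool" where
  "constant_holomorphic_curvature M \<phi> \<xi> g nabla c \<longleftrightarrow>
     (\<forall>p\<in>points M. \<forall>v\<in>tangent_space M p. v \<noteq> 0 \<longrightarrow> g p v (\<xi> p) = 0 \<longrightarrow>
        has_sectional_curvature M g nabla p v (\<phi> p v) c)"

definition conformal_kenmotsu_space_form :: "nat \<Rightarrow> ('a, 'e::euclidean_space) mfd \<Rightarrow>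
    ('a \<Rightarrow> 'a tvec \<Rightarrow> 'a tvec) \<Rightarrow> ('a \<Rightarrow> 'a tvec) \<Rightarrow> ('a \<Rightarrow> 'a tvec \<Rightarrow> real) \<Rightarrow>
    ('a \<Rightarrow> 'a tvec \<Rightarrow> 'a tvec \<Rightarrow> real) \<Rightarrow> ('a \<Rightarrow> real) \<Rightarrow> real \<Rightarrow> bool" where
  "conformal_kenmotsu_space_form n M \<phi> \<xi> \<eta> g f c \<longleftrightarrow>
     almost_contact_metric n M \<phi> \<xi> \<eta> g \<and>
     smooth_fun M (points M) f \<and> (\<forall>p\<in>points M. f p > 0) \<and>
     (let \<xi>' = (\<lambda>p. exp (- f p / 2) *\<^sub>R \<xi> p);
          \<eta>' = (\<lambda>p v. exp (f p / 2) * \<eta> p v);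
          g' = (\<lambda>p v w. exp (f p) * g p v w)
      in \<exists>nabla'. kenmotsu n M \<phi> \<xi>' \<eta>' g' nabla' \<and> constant_holomorphic_curvature M \<phi> \<xi>' g' nabla' c)"

text \<open>\<open>\<omega>(X) = X(f)\<close>, and the Lee vector field is its metric dual, the gradient of \<open>f\<close>.\<close>

definition lee_form :: "('a \<Rightarrow> real) \<Rightarrow> 'a \<Rightarrow> 'a tvec \<Rightarrow> real" where
  "lee_form f p v = v f"

definition lee_vector_field :: "('a, 'e::euclidean_space) mfd \<Rightarrow>
    ('a \<Rightarrow> 'a tvec \<Rightarrow> 'a tvec \<Rightarrow> real) \<Rightarrow> ('a \<Rightarrow> real) \<Rightarrow> ('a \<Rightarrow> 'a tvec) \<Rightarrow> bool" where
  "lee_vector_field M g f L \<longleftrightarrow>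
     (\<forall>p\<in>points M. L p \<in> tangent_space M p \<and> (\<forall>v\<in>tangent_space M p. g p (L p) v = lee_form f p v))"

definition smooth_map ::
  "('a, 'e::euclidean_space) mfd \<Rightarrow> ('b, 'h::euclidean_space) mfd \<Rightarrow> ('a \<Rightarrow> 'b) \<Rightarrow> bool" where
  "smooth_map M N F \<longleftrightarrow> continuous_map (topo M) (topo N) F \<and>
     (\<forall>(U, \<kappa>)\<in>atlas M. \<forall>(V, \<psi>)\<in>atlas N. smooth_on (\<kappa> ` (U \<inter> F -` V)) (\<psi> \<circ> F \<circ> inv_into U \<kappa>))"

definition differential :: "('b, 'h::euclidean_space) mfd \<Rightarrow> ('a \<Rightarrow> 'b) \<Rightarrow> 'a \<Rightarrow> 'a tvec \<Rightarrow> 'b tvec" where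
  "differential N F p v = (\<lambda>h. if smooth_near N (F p) h then v (h \<circ> F) else 0)"

definition immersion ::
  "('a, 'e::euclidean_space) mfd \<Rightarrow> ('b, 'h::euclidean_space) mfd \<Rightarrow> ('a \<Rightarrow> 'b) \<Rightarrow> bool" where
  "immersion M N F \<longleftrightarrow> smooth_map M N F \<and>
     (\<forall>p\<in>points M. inj_on (differential N F p) (tangent_space M p))"

text \<open>An embedded submanifold is a subset with the subspace topology and a smooth structure for which
  the inclusion is an immersion. Its tangent vectors are operators on functions on the submanifold;
  \<open>push M p\<close> is the canonical map into \<open>T\<^sub>pM\<close>.\<close>

definition embedded_submanifold ::
  "nat \<Rightarrow> ('a, 'h::euclidean_space) mfd \<Rightarrow> ('a, 'e::euclidean_space) mfd \<Rightarrow> bool" where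
  "embedded_submanifold m S M \<longleftrightarrow> smooth_manifold m S \<and> points S \<subseteq> points M \<and>
     topo S = subtopology (topo M) (points S) \<and> immersion S M id"

abbreviation push :: "('a, 'e::euclidean_space) mfd \<Rightarrow> 'a \<Rightarrow> 'a tvec \<Rightarrow> 'a tvec" where
  "push M \<equiv> differential M id"

definition induced_metric :: "('a, 'e::euclidean_space) mfd \<Rightarrow>
    ('a \<Rightarrow> 'a tvec \<Rightarrow> 'a tvec \<Rightarrow> real) \<Rightarrow> 'a \<Rightarrow> 'a tvec \<Rightarrow> 'a tvec \<Rightarrow> real" where
  "induced_metric M g p v w = g p (push M p v) (push M p w)"

definition normal_space :: "('a, 'e::euclidean_space) mfd \<Rightarrow> ('a \<Rightarrow> 'a tvec \<Rightarrow> 'a tvec \<Rightarrow> real) \<Rightarrow>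
    ('a, 'h::euclidean_space) mfd \<Rightarrow> 'a \<Rightarrow> 'a tvec set" where
  "normal_space M g S p = {w \<in> tangent_space M p. \<forall>v\<in>tangent_space S p. g p w (push M p v) = 0}"

text \<open>A vector field along \<open>S\<close> is smooth if it extends locally to smooth vector fields of \<open>M\<close>.\<close>

definition smooth_along ::
  "('a, 'e::euclidean_space) mfd \<Rightarrow> 'a set \<Rightarrow> ('a \<Rightarrow> 'a tvec) \<Rightarrow> bool" where
  "smooth_along M S N \<longleftrightarrow> (\<forall>p\<in>S. \<exists>W Z. p \<in> W \<and> smooth_vf M W Z \<and> (\<forall>q\<in>W \<inter> S. Z q = N q))"

definition unit_normal_field :: "('a, 'e::euclidean_space) mfd \<Rightarrow>
    ('a \<Rightarrow> 'a tvec \<Rightarrow> 'a tvec \<Rightarrow> real) \<Rightarrow> ('a, 'h::euclidean_space) mfd \<Rightarrow> ('a \<Rightarrow> 'a tvec) \<Rightarrow> bool" where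
  "unit_normal_field M g S N \<longleftrightarrow> smooth_along M (points S) N \<and>
     (\<forall>p\<in>points S. N p \<in> normal_space M g S p \<and> g p (N p) (N p) = 1)"

text \<open>\<open>AX = -\<nabla>\<^sub>X N\<close>, where \<open>\<nabla>\<^sub>X N\<close> for \<open>X\<close> tangent to \<open>S\<close> is computed from any local extension \<open>Z\<close> of \<open>N\<close>.\<close>

definition shape_operator :: "('a, 'e::euclidean_space) mfd \<Rightarrow> 'a connection \<Rightarrow>
    ('a, 'h::euclidean_space) mfd \<Rightarrow> ('a \<Rightarrow> 'a tvec) \<Rightarrow> ('a \<Rightarrow> 'a tvec \<Rightarrow> 'a tvec) \<Rightarrow> bool" where
  "shape_operator M nabla S N A \<longleftrightarrow>
     (\<forall>p\<in>points S. \<forall>v\<in>tangent_space S p. A p v \<in> tangent_space S p \<and>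
        (\<forall>W Z. p \<in> W \<longrightarrow> smooth_vf M W Z \<longrightarrow> (\<forall>q\<in>W \<inter> points S. Z q = N q) \<longrightarrow>
           push M p (A p v) = - nabla p (push M p v) Z))"

definition distribution ::
  "('a, 'e::euclidean_space) mfd \<Rightarrow> nat \<Rightarrow> ('a \<Rightarrow> 'a tvec set) \<Rightarrow> bool" where
  "distribution M k D \<longleftrightarrow> (\<forall>p\<in>points M. \<exists>W X. p \<in> W \<and> openin (topo M) W \<and>
     (\<forall>i<k. smooth_vf M W (X i)) \<and>
     (\<forall>q\<in>W. inj_on (\<lambda>i. X i q) {..<k} \<and> independent ((\<lambda>i. X i q) ` {..<k}) \<and>
        D q = span ((\<lambda>i. X i q) ` {..<k})))"

definition cr_hypersurface :: "nat \<Rightarrow> ('a, 'e::euclidean_space) mfd \<Rightarrow>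
    ('a \<Rightarrow> 'a tvec \<Rightarrow> 'a tvec) \<Rightarrow> ('a \<Rightarrow> 'a tvec) \<Rightarrow> ('a \<Rightarrow> 'a tvec \<Rightarrow> 'a tvec \<Rightarrow> real) \<Rightarrow>
    ('a, 'h::euclidean_space) mfd \<Rightarrow> ('a \<Rightarrow> 'a tvec set) \<Rightarrow> ('a \<Rightarrow> 'a tvec set) \<Rightarrow> bool" where
  "cr_hypersurface n M \<phi> \<xi> g S D E \<longleftrightarrow>
     embedded_submanifold (2 * n) S M \<and>
     (\<exists>k. distribution S k D) \<and> (\<exists>k. distribution S k E) \<and>
     (\<forall>p\<in>points S.
        \<xi> p \<in> push M p ` tangent_space S p \<and>
        tangent_space S p = {v + w | v w. v \<in> D p \<and> w \<in> E p} \<and>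
        (\<forall>v\<in>D p. \<forall>w\<in>E p. induced_metric M g p v w = 0) \<and>
        \<phi> p ` push M p ` D p \<subseteq> push M p ` D p \<and>
        \<phi> p ` push M p ` E p \<subseteq> normal_space M g S p)"

definition recurrent ::
  "('a, 'e::euclidean_space) mfd \<Rightarrow> 'a connection \<Rightarrow> ('a \<Rightarrow> 'a tvec \<Rightarrow> 'a tvec) \<Rightarrow> bool" where
  "recurrent S nabla A \<longleftrightarrow> (\<exists>\<alpha>. one_form S \<alpha> \<and>
     (\<forall>W Y. smooth_vf S W Y \<longrightarrow> (\<forall>p\<in>W. \<forall>v\<in>tangent_space S p.
        cov_deriv_tensor11 nabla A p v Y = \<alpha> p v *\<^sub>R A p (Y p))))"

definition totally_umbilic ::
  "('a, 'e::euclidean_space) mfd \<Rightarrow> ('a \<Rightarrow> 'a tvec \<Rightarrow> 'a tvec) \<Rightarrow> bool" where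
  "totally_umbilic S A \<longleftrightarrow> (\<exists>\<mu>. \<forall>p\<in>points S. \<forall>v\<in>tangent_space S p. A p v = \<mu> p *\<^sub>R v)"

end

theory Submission
  imports Defs
begin

text \<open>The Kenmotsu identity says \<open>\<nabla>'\<^sub>X\<xi>' = X - \<eta>'(X)\<xi>'\<close> for \<open>\<xi>' = e\<^bsup>-f/2\<^esup>\<xi>\<close>, and the conformal change of the
  Levi-Civita connection turns this into
  \<open>\<nabla>\<^sub>X\<xi> = e\<^bsup>f/2\<^esup>(X - \<eta>(X)\<xi>) - \<omega>(\<xi>)X/2 + \<eta>(X)grad f/2\<close>.
  Along \<open>S\<close>, where \<open>grad f = N\<close> is normal and \<open>\<xi>\<close> is tangent, the normal part of this formula is
  \<open>A\<xi> = \<xi>/2\<close> and its tangential part is \<open>\<nabla>\<^sub>X\<xi> = e\<^bsup>f/2\<^esup>(X - \<eta>(X)\<xi>)\<close> for the connection of \<open>S\<close>.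
  Applied to \<open>\<xi>\<close>, recurrence therefore reads \<open>e\<^bsup>f/2\<^esup>(X/2 - AX) = \<alpha>(X)\<xi>/2\<close>. The \<open>\<xi>\<close>-component of the
  left side vanishes since \<open>A\<close> is symmetric, so \<open>\<alpha> = 0\<close> and \<open>A = Id/2\<close>.\<close>

section \<open>Calculus of smooth maps\<close>

text \<open>The symmetry of \<open>A\<close> comes from \<open>N\<close> being a gradient: on
  vectors tangent to \<open>S\<close>, \<open>A\<close> is minus the Hessian of \<open>f\<close>.
  The eigenvalue 1/2 is the coefficient of grad f in the conformal change from g to exp(f) g,
  combined with g(N, N) = 1. Tangent vectors are operators on functions, so vectors of
  \<open>S\<close> and of \<open>M\<close> live in different spaces linked by \<open>push\<close>,
  and a connection accepts only fields of its own manifold. Fields on \<open>S\<close> are therefore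
  differentiated through their components in a chart of \<open>M\<close>. Two fields that the
  argument differentiates, grad f and \<xi> regarded as a field on \<open>S\<close>, are given only
  pointwise; their smoothness is recovered from that of their inner products with smooth fields.
  Both comparisons of connections, the conformal one and the Gauss formula, follow the uniqueness
  proof for torsion-free metric connections.\<close>

lemma frechet_derivative_cong_open:
  assumes "open S" "x \<in> S" "\<And>y. y \<in> S \<Longrightarrow> f y = g y"
  shows "frechet_derivative f (at x) = frechet_derivative g (at x)"
proof -
  have "(f has_derivative D) (at x) \<longleftrightarrow> (g has_derivative D) (at x)" for D
    using has_derivative_transform_within_open[OF _ assms(1,2), of f D UNIV g]
      has_derivative_transform_within_open[OF _ assms(1,2), of g D UNIV f] assms(3) by auto
  then show ?thesis unfolding frechet_derivative_def by simp
qed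

lemma differentiable_cong_open:
  assumes "open S" "x \<in> S" "\<And>y. y \<in> S \<Longrightarrow> f y = g y" "f differentiable (at x)"
  shows "g differentiable (at x)"
  using assms has_derivative_transform_within_open[OF _ assms(1,2), of f _ UNIV g]
  unfolding differentiable_def by metis

lemma Ck_on_cong:
  assumes "open S" "\<And>x. x \<in> S \<Longrightarrow> f x = g x" "Ck_on k S f"
  shows "Ck_on k S g"
  using assms(2,3)
proof (induction k arbitrary: f g)
  case 0
  then show ?case using continuous_on_cong[of S S f g] by simp
next
  case (Suc k)
  have "g differentiable (at x)" if "x \<in> S" for x
    using differentiable_cong_open[OF assms(1) that, of f g] Suc.prems that by simp
  moreover have "Ck_on k S (\<lambda>x. frechet_derivative g (at x) v)" for v
  proof (rule Suc.IH)
    show "Ck_on k S (\<lambda>x. frechet_derivative f (at x) v)" using Suc.prems by simp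
    show "frechet_derivative f (at x) v = frechet_derivative g (at x) v" if "x \<in> S" for x
      using frechet_derivative_cong_open[OF assms(1) that, of f g] Suc.prems by simp
  qed
  ultimately show ?case by simp
qed

lemma Ck_on_subset: "Ck_on k S f \<Longrightarrow> T \<subseteq> S \<Longrightarrow> Ck_on k T f"
  by (induction k arbitrary: f) (auto intro: continuous_on_subset)

text \<open>\<open>Ck_on (Suc k)\<close> does not list \<open>Ck_on k\<close> among its clauses: at
  level 0 it comes from differentiability implying continuity, above that from the
  derivatives.\<close>

lemma Ck_on_SucD: "Ck_on (Suc k) S f \<Longrightarrow> Ck_on k S f"
proof (induction k arbitrary: f)
  case 0
  then show ?case
    by (auto intro!: continuous_at_imp_continuous_on differentiable_imp_continuous_within)
next
  case (Suc k)
  then show ?case by (metis Ck_on.simps(2))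
qed

lemma Ck_on_local:
  assumes "\<And>x. x \<in> S \<Longrightarrow> \<exists>T. open T \<and> x \<in> T \<and> Ck_on k T f"
  shows "Ck_on k S f"
  using assms
proof (induction k arbitrary: f)
  case 0
  show ?case
    by (simp, rule continuous_at_imp_continuous_on)
       (use 0 in \<open>metis Ck_on.simps(1) continuous_on_eq_continuous_at\<close>)
next
  case (Suc k)
  have "f differentiable (at x)" if "x \<in> S" for x using Suc.prems[OF that] by auto
  moreover have "Ck_on k S (\<lambda>x. frechet_derivative f (at x) v)" for v
    by (rule Suc.IH) (use Suc.prems in fastforce)
  ultimately show ?case by simp
qed

text \<open>Lets later proofs supply an explicit derivative \<open>D\<close>; by uniqueness of
  derivatives it agrees with \<open>frechet_derivative\<close> on the open set.\<close>

lemma Ck_on_SucI: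
  assumes "open S" "\<And>x. x \<in> S \<Longrightarrow> (f has_derivative D x) (at x)" "\<And>v. Ck_on k S (\<lambda>x. D x v)"
  shows "Ck_on (Suc k) S f"
proof -
  have "Ck_on k S (\<lambda>x. frechet_derivative f (at x) v)" for v
  proof (rule Ck_on_cong[OF assms(1) _ assms(3)])
    show "D x v = frechet_derivative f (at x) v" if "x \<in> S" for x
      using frechet_derivative_at[OF assms(2)[OF that]] by simp
  qed
  then show ?thesis using assms(2) by (auto simp: differentiable_def)
qed

lemma Ck_on_Suc_derivative:
  "Ck_on (Suc k) S f \<Longrightarrow> x \<in> S \<Longrightarrow> (f has_derivative frechet_derivative f (at x)) (at x)"
  using Ck_on.simps(2) frechet_derivative_works by blast

lemma Ck_on_Suc_frechet: "Ck_on (Suc k) S f \<Longrightarrow> Ck_on k S (\<lambda>x. frechet_derivative f (at x) v)"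
  by simp

section \<open>Closure properties of C^k maps\<close>

lemma Ck_on_const: "open S \<Longrightarrow> Ck_on k S (\<lambda>x. c)"
proof (induction k arbitrary: c)
  case (Suc k)
  show ?case by (rule Ck_on_SucI[where D = "\<lambda>x v. 0"]) (auto simp: Suc)
qed simp

lemma Ck_on_bounded_linear:
  assumes "open S" "bounded_linear L"
  shows "Ck_on k S f \<Longrightarrow> Ck_on k S (\<lambda>x. L (f x))"
proof (induction k arbitrary: f)
  case 0
  then show ?case using bounded_linear.continuous_on[OF assms(2)] by auto
next
  case (Suc k)
  show ?case
  proof (rule Ck_on_SucI[OF assms(1), where D = "\<lambda>x v. L (frechet_derivative f (at x) v)"])
    show "((\<lambda>x. L (f x)) has_derivative (\<lambda>v. L (frechet_derivative f (at x) v))) (at x)" if "x \<in> S" for x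
      by (rule bounded_linear.has_derivative[OF assms(2) Ck_on_Suc_derivative[OF Suc.prems that]])
    show "Ck_on k S (\<lambda>x. L (frechet_derivative f (at x) v))" for v
      by (rule Suc.IH[OF Ck_on_Suc_frechet[OF Suc.prems]])
  qed
qed

lemma Ck_on_ident: "open S \<Longrightarrow> Ck_on k S (\<lambda>x. x)"
  by (cases k) (auto intro!: Ck_on_SucI[where D = "\<lambda>x v. v"] Ck_on_const)

lemma Ck_on_add:
  assumes "open S"
  shows "Ck_on k S f \<Longrightarrow> Ck_on k S g \<Longrightarrow> Ck_on k S (\<lambda>x. f x + g x)"
proof (induction k arbitrary: f g)
  case 0
  then show ?case by (auto intro: continuous_intros)
next
  case (Suc k)
  show ?case
  proof (rule Ck_on_SucI[OF assms(1),
        where D = "\<lambda>x v. frechet_derivative f (at x) v + frechet_derivative g (at x) v"])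
    show "((\<lambda>x. f x + g x) has_derivative
        (\<lambda>v. frechet_derivative f (at x) v + frechet_derivative g (at x) v)) (at x)" if "x \<in> S" for x
      by (intro has_derivative_add Ck_on_Suc_derivative[OF Suc.prems(1) that] Ck_on_Suc_derivative[OF Suc.prems(2) that])
    show "Ck_on k S (\<lambda>x. frechet_derivative f (at x) v + frechet_derivative g (at x) v)" for v
      by (intro Suc.IH Ck_on_Suc_frechet Suc.prems)
  qed
qed

lemma Ck_on_bilinear:
  assumes "open S" "bounded_bilinear B"
  shows "Ck_on k S f \<Longrightarrow> Ck_on k S g \<Longrightarrow> Ck_on k S (\<lambda>x. B (f x) (g x))"
proof (induction k arbitrary: f g)
  case 0
  then show ?case using bounded_bilinear.continuous_on[OF assms(2)] by auto
next
  case (Suc k)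
  \<comment> \<open>The product rule leaves one factor undifferentiated, and the induction
    hypothesis needs that factor at level \<open>k\<close>.\<close>
  note low = Suc.prems[THEN Ck_on_SucD]
  show ?case
  proof (rule Ck_on_SucI[OF assms(1), where D = "\<lambda>x v. B (f x) (frechet_derivative g (at x) v)
        + B (frechet_derivative f (at x) v) (g x)"])
    show "((\<lambda>x. B (f x) (g x)) has_derivative (\<lambda>v. B (f x) (frechet_derivative g (at x) v)
        + B (frechet_derivative f (at x) v) (g x))) (at x)" if "x \<in> S" for x
      by (intro bounded_bilinear.FDERIV[OF assms(2)] Ck_on_Suc_derivative[OF Suc.prems(1) that]
          Ck_on_Suc_derivative[OF Suc.prems(2) that])
    show "Ck_on k S (\<lambda>x. B (f x) (frechet_derivative g (at x) v)
        + B (frechet_derivative f (at x) v) (g x))" for v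
      by (intro Ck_on_add[OF assms(1)] Suc.IH Ck_on_Suc_frechet Suc.prems low)
  qed
qed

lemma Ck_on_sum:
  assumes "open S" "\<And>i. i \<in> I \<Longrightarrow> Ck_on k S (f i)"
  shows "Ck_on k S (\<lambda>x. \<Sum>i\<in>I. f i x)"
  using assms(2)
proof (induction I rule: infinite_finite_induct)
  case (insert i I)
  then show ?case using Ck_on_add[OF assms(1)] by auto
qed (auto simp: Ck_on_const[OF assms(1)])

text \<open>In the chain rule the direction in which \<open>f\<close> is differentiated moves with
  \<open>x\<close>, while \<open>Ck_on\<close> speaks of fixed directions. Expanding in the basis of
  the finite-dimensional middle space leaves fixed directions with C^k coefficients.\<close>

lemma Ck_on_compose:
  fixes g :: "'a::real_normed_vector \<Rightarrow> 'b::euclidean_space" and f :: "'b \<Rightarrow> 'c::real_normed_vector"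
  assumes "open S" "open T" "g ` S \<subseteq> T"
  shows "Ck_on k T f \<Longrightarrow> Ck_on k S g \<Longrightarrow> Ck_on k S (\<lambda>x. f (g x))"
proof (induction k arbitrary: f)
  case 0
  then show ?case using continuous_on_compose2[of T f S g] assms by auto
next
  case (Suc k)
  let ?f = "\<lambda>y. frechet_derivative f (at y)" and ?g = "\<lambda>x. frechet_derivative g (at x)"
  note f = Ck_on_Suc_derivative[OF Suc.prems(1)] Ck_on_Suc_frechet[OF Suc.prems(1)]
  note g = Ck_on_Suc_derivative[OF Suc.prems(2)] Ck_on_Suc_frechet[OF Suc.prems(2)]
  note low = Suc.prems(2)[THEN Ck_on_SucD]
  show ?case
  proof (rule Ck_on_SucI[OF assms(1), where D = "\<lambda>x v. \<Sum>b\<in>Basis. (?g x v \<bullet> b) *\<^sub>R ?f (g x) b"])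
    fix x assume x: "x \<in> S"
    have F: "(f has_derivative ?f (g x)) (at (g x))" using f(1) x assms(3) by auto
    have chain: "((\<lambda>x. f (g x)) has_derivative (\<lambda>v. ?f (g x) (?g x v))) (at x)"
      using diff_chain_at[OF g(1)[OF x] F] by (simp add: o_def)
    have expand: "?f (g x) w = (\<Sum>b\<in>Basis. (w \<bullet> b) *\<^sub>R ?f (g x) b)" for w
    proof -
      have "linear (?f (g x))" using F has_derivative_linear by blast
      then have "?f (g x) (\<Sum>b\<in>Basis. (w \<bullet> b) *\<^sub>R b) = (\<Sum>b\<in>Basis. (w \<bullet> b) *\<^sub>R ?f (g x) b)"
        by (simp add: linear_sum linear_scale)
      then show ?thesis by (simp add: euclidean_representation)
    qed
    show "((\<lambda>x. f (g x)) has_derivative (\<lambda>v. \<Sum>b\<in>Basis. (?g x v \<bullet> b) *\<^sub>R ?f (g x) b)) (at x)"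
      unfolding expand[symmetric] by (rule chain)
  next
    fix v
    show "Ck_on k S (\<lambda>x. \<Sum>b\<in>Basis. (?g x v \<bullet> b) *\<^sub>R ?f (g x) b)"
      by (rule Ck_on_sum[OF assms(1)],
          rule Ck_on_bilinear[OF assms(1) bounded_bilinear_scaleR
            Ck_on_bounded_linear[OF assms(1) bounded_linear_inner_left g(2)] Suc.IH[OF f(2) low]])
  qed
qed

lemma Ck_on_inverse: "Ck_on k (- {0}) (inverse :: real \<Rightarrow> real)"
proof (induction k)
  case 0
  show ?case by (auto intro: continuous_intros)
next
  case (Suc k)
  have o: "open (- {0::real})" by auto
  show ?case
  \<comment> \<open>The derivative is a product of constants and of \<open>inverse\<close> itself,
    so the bilinear rule and the induction hypothesis suffice; this is why the sign appears as a
    factor \<open>- 1\<close>.\<close>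
  proof (rule Ck_on_SucI[OF o, where D = "\<lambda>x v. - 1 * ((inverse x * v) * inverse x)"])
    show "(inverse has_derivative (\<lambda>v. - 1 * ((inverse x * v) * inverse x))) (at x)"
      if "x \<in> - {0}" for x :: real
      using has_derivative_inverse'[of x UNIV] that by simp
    show "Ck_on k (- {0}) (\<lambda>x::real. - 1 * ((inverse x * v) * inverse x))" for v
      by (intro Ck_on_bilinear[OF o bounded_bilinear_mult] Ck_on_const[OF o] Suc)
  qed
qed

lemma Ck_on_exp: "Ck_on k UNIV (exp :: real \<Rightarrow> real)"
proof (induction k)
  case 0
  show ?case by (simp add: continuous_on_exp)
next
  case (Suc k)
  show ?case
  proof (rule Ck_on_SucI[OF open_UNIV, where D = "\<lambda>x v. exp x * v"])
    show "(exp has_derivative (\<lambda>v. exp x * v)) (at x)" for x :: real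
      using DERIV_exp[of x] by (simp add: has_field_derivative_def)
    show "Ck_on k UNIV (\<lambda>x::real. exp x * v)" for v
      by (intro Ck_on_bilinear[OF open_UNIV bounded_bilinear_mult] Ck_on_const[OF open_UNIV] Suc)
  qed
qed

section \<open>The same rules for smooth maps\<close>

lemma smooth_on_has_derivative:
  assumes "smooth_on S f" "x \<in> S"
  shows "(f has_derivative frechet_derivative f (at x)) (at x)"
  by (rule Ck_on_Suc_derivative[of 0, OF _ assms(2)]) (use assms(1) in \<open>simp only: smooth_on_def\<close>)

lemma smooth_on_frechet:
  assumes "smooth_on S f"
  shows "smooth_on S (\<lambda>x. frechet_derivative f (at x) v)"
  unfolding smooth_on_def by (intro allI Ck_on_Suc_frechet) (use assms in \<open>simp only: smooth_on_def\<close>)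

lemma smooth_on_cong:
  "open S \<Longrightarrow> (\<And>x. x \<in> S \<Longrightarrow> f x = g x) \<Longrightarrow> smooth_on S f \<Longrightarrow> smooth_on S g"
  unfolding smooth_on_def by (metis Ck_on_cong)

lemma smooth_on_subset: "smooth_on S f \<Longrightarrow> T \<subseteq> S \<Longrightarrow> smooth_on T f"
  unfolding smooth_on_def by (metis Ck_on_subset)

lemma smooth_on_local:
  assumes "\<And>x. x \<in> S \<Longrightarrow> \<exists>T. open T \<and> x \<in> T \<and> smooth_on T f"
  shows "smooth_on S f"
  using assms unfolding smooth_on_def by (meson Ck_on_local)

lemma smooth_on_compose:
  fixes g :: "'a::real_normed_vector \<Rightarrow> 'b::euclidean_space"
  shows "open S \<Longrightarrow> open T \<Longrightarrow> g ` S \<subseteq> T \<Longrightarrow> smooth_on T f \<Longrightarrow> smooth_on S g \<Longrightarrow> smooth_on S (\<lambda>x. f (g x))"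
  unfolding smooth_on_def by (metis Ck_on_compose)

lemma smooth_on_const: "open S \<Longrightarrow> smooth_on S (\<lambda>x. c)"
  unfolding smooth_on_def by (simp add: Ck_on_const)

lemma smooth_on_inner: "open S \<Longrightarrow> smooth_on S f \<Longrightarrow> smooth_on S (\<lambda>x. f x \<bullet> b)"
  unfolding smooth_on_def by (simp add: Ck_on_bounded_linear[OF _ bounded_linear_inner_left])

lemma smooth_on_ident: "open S \<Longrightarrow> smooth_on S (\<lambda>x. x)"
  unfolding smooth_on_def by (simp add: Ck_on_ident)

lemma smooth_on_add: "open S \<Longrightarrow> smooth_on S f \<Longrightarrow> smooth_on S g \<Longrightarrow> smooth_on S (\<lambda>x. f x + g x)"
  unfolding smooth_on_def by (simp add: Ck_on_add)

lemma smooth_on_mult: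
  fixes f g :: "_ \<Rightarrow> real"
  shows "open S \<Longrightarrow> smooth_on S f \<Longrightarrow> smooth_on S g \<Longrightarrow> smooth_on S (\<lambda>x. f x * g x)"
  unfolding smooth_on_def by (simp add: Ck_on_bilinear[OF _ bounded_bilinear_mult])

lemma smooth_on_exp: "smooth_on UNIV (exp :: real \<Rightarrow> real)"
  unfolding smooth_on_def by (simp add: Ck_on_exp)

lemma smooth_on_inverse: "smooth_on (- {0}) (inverse :: real \<Rightarrow> real)"
  unfolding smooth_on_def by (simp add: Ck_on_inverse)

section \<open>Manifolds, tangent vectors and vector fields\<close>

lemma sum_fun_apply: "(\<Sum>i\<in>I. F i) x = (\<Sum>i\<in>I. F i x)"
  by (induction I rule: infinite_finite_induct) auto

lemma linear_map_on_add: "linear_map_on V L \<Longrightarrow> v \<in> V \<Longrightarrow> w \<in> V \<Longrightarrow> L (v + w) = L v + L w"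
  by (simp add: linear_map_on_def)

lemma linear_map_on_scaleR: "linear_map_on V L \<Longrightarrow> v \<in> V \<Longrightarrow> L (a *\<^sub>R v) = a *\<^sub>R L v"
  by (simp add: linear_map_on_def)

lemma linear_map_on_sum:
  assumes "linear_map_on V L" "subspace V" "\<And>i. i \<in> I \<Longrightarrow> v i \<in> V"
  shows "L (\<Sum>i\<in>I. c i *\<^sub>R v i) = (\<Sum>i\<in>I. c i *\<^sub>R L (v i))"
  using assms(3)
proof (induction I rule: infinite_finite_induct)
  case (insert i I)
  then show ?case
    using linear_map_on_add[OF assms(1), of "c i *\<^sub>R v i" "\<Sum>i\<in>I. c i *\<^sub>R v i"] assms(2)
    by (simp add: linear_map_on_scaleR[OF assms(1)] subspace_scale subspace_sum)
qed (use linear_map_on_scaleR[OF assms(1), of 0 0] assms(2) subspace_0 in auto)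

text \<open>The operator under the quantifiers of \<open>tangent_space\<close>, named so that
  linearity in \<open>u\<close> and change of chart can be stated.\<close>

definition chart_vec ::
  "('a, 'e::euclidean_space) mfd \<Rightarrow> 'a set \<Rightarrow> ('a \<Rightarrow> 'e) \<Rightarrow> 'a \<Rightarrow> 'e \<Rightarrow> 'a tvec" where
  "chart_vec M U \<kappa> p u =
     (\<lambda>f. if smooth_near M p f then frechet_derivative (f \<circ> inv_into U \<kappa>) (at (\<kappa> p)) u else 0)"

section \<open>Charts\<close>

locale smooth_mfd =
  fixes M :: "('a, 'e::euclidean_space) mfd" and m :: nat
  assumes smooth_manifold: "smooth_manifold m M"
begin

lemma chart_openin: "(U, \<kappa>) \<in> atlas M \<Longrightarrow> openin (topo M) U"
  using smooth_manifold unfolding smooth_manifold_def by fast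

lemma chart_homeomorphic:
  "(U, \<kappa>) \<in> atlas M \<Longrightarrow> homeomorphic_map (subtopology (topo M) U) (top_of_set (\<kappa> ` U)) \<kappa>"
  using smooth_manifold unfolding smooth_manifold_def by fast

lemma chart_transition:
  "(U, \<kappa>) \<in> atlas M \<Longrightarrow> (V, \<psi>) \<in> atlas M \<Longrightarrow> smooth_on (\<kappa> ` (U \<inter> V)) (\<psi> \<circ> inv_into U \<kappa>)"
  using smooth_manifold unfolding smooth_manifold_def by fast

lemma chart_subset: "(U, \<kappa>) \<in> atlas M \<Longrightarrow> U \<subseteq> points M"
  using chart_openin openin_subset by (metis points_def)

lemma chart_inj: assumes "(U, \<kappa>) \<in> atlas M" shows "inj_on \<kappa> U"
proof -
  have "topspace (subtopology (topo M) U) = U"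
    using chart_subset[OF assms] by (auto simp: points_def)
  then show ?thesis
    using homeomorphic_imp_injective_map[OF chart_homeomorphic[OF assms]] by simp
qed

lemma chart_inv: "(U, \<kappa>) \<in> atlas M \<Longrightarrow> p \<in> U \<Longrightarrow> inv_into U \<kappa> (\<kappa> p) = p"
  using chart_inj by simp

lemma chart_at:
  assumes "p \<in> points M" obtains U \<kappa> where "(U, \<kappa>) \<in> atlas M" "p \<in> U"
  using assms smooth_manifold unfolding smooth_manifold_def by blast

lemma open_chart_image:
  assumes "(U, \<kappa>) \<in> atlas M" "openin (topo M) W" "W \<subseteq> U"
  shows "open (\<kappa> ` W)"
proof -
  have U: "open (\<kappa> ` U)" using smooth_manifold assms(1) unfolding smooth_manifold_def by fast
  have "openin (subtopology (topo M) U) W"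
    using assms by (simp add: openin_open_subtopology[OF chart_openin])
  then have "openin (top_of_set (\<kappa> ` U)) (\<kappa> ` W)"
    using homeomorphic_imp_open_map[OF chart_homeomorphic[OF assms(1)]] by (simp add: open_map_def)
  then show ?thesis using U openin_open_trans by blast
qed

lemma openin_Int_chart: "(U, \<kappa>) \<in> atlas M \<Longrightarrow> openin (topo M) W \<Longrightarrow> openin (topo M) (U \<inter> W)"
  by (simp add: chart_openin openin_Int)

section \<open>Smooth functions on open subsets of a manifold\<close>

lemma smooth_fun_openin: "smooth_fun M W f \<Longrightarrow> openin (topo M) W"
  by (simp add: smooth_fun_def)

lemma smooth_fun_chartD:
  assumes "smooth_fun M W f" "(U, \<kappa>) \<in> atlas M" "W' \<subseteq> U \<inter> W"
  shows "smooth_on (\<kappa> ` W') (f \<circ> inv_into U \<kappa>)"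
proof -
  have "smooth_on (\<kappa> ` (U \<inter> W)) (f \<circ> inv_into U \<kappa>)" using assms unfolding smooth_fun_def by fast
  then show ?thesis by (rule smooth_on_subset) (use assms(3) in auto)
qed

text \<open>The transition maps carry smoothness in one chart around a point over to all other
  charts.\<close>

lemma smooth_funI:
  assumes W: "openin (topo M) W"
    and loc: "\<And>p. p \<in> W \<Longrightarrow> \<exists>U \<kappa> W'. (U, \<kappa>) \<in> atlas M \<and> openin (topo M) W' \<and> p \<in> W' \<and> W' \<subseteq> U \<inter> W \<and>
      smooth_on (\<kappa> ` W') (f \<circ> inv_into U \<kappa>)"
  shows "smooth_fun M W f"
proof -
  have "smooth_on (\<kappa>1 ` (U1 \<inter> W)) (f \<circ> inv_into U1 \<kappa>1)" if U1: "(U1, \<kappa>1) \<in> atlas M" for U1 \<kappa>1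
  proof (rule smooth_on_local)
    fix x assume "x \<in> \<kappa>1 ` (U1 \<inter> W)"
    then obtain q where q: "q \<in> U1" "q \<in> W" "x = \<kappa>1 q" by auto
    obtain U \<kappa> W' where U: "(U, \<kappa>) \<in> atlas M" and W': "openin (topo M) W'" "q \<in> W'" "W' \<subseteq> U \<inter> W"
      and sm: "smooth_on (\<kappa> ` W') (f \<circ> inv_into U \<kappa>)" using loc[OF q(2)] by blast
    let ?T = "\<kappa>1 ` (U1 \<inter> W')"
    have T: "open ?T" using open_chart_image[OF U1 openin_Int_chart[OF U1 W'(1)]] by blast
    have o: "open (\<kappa> ` W')" using open_chart_image[OF U W'(1)] W'(3) by blast
    have tr: "smooth_on ?T (\<kappa> \<circ> inv_into U1 \<kappa>1)"
      by (rule smooth_on_subset[OF chart_transition[OF U1 U]]) (use W' in auto)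
    have "smooth_on ?T (\<lambda>y. (f \<circ> inv_into U \<kappa>) ((\<kappa> \<circ> inv_into U1 \<kappa>1) y))"
      by (rule smooth_on_compose[OF T o _ sm tr]) (auto simp: chart_inv[OF U1])
    then have "smooth_on ?T (f \<circ> inv_into U1 \<kappa>1)"
    proof (rule smooth_on_cong[OF T, rotated])
      fix y assume "y \<in> ?T"
      then obtain r where "r \<in> U1" "r \<in> U" "y = \<kappa>1 r" using W' by auto
      then show "(f \<circ> inv_into U \<kappa>) ((\<kappa> \<circ> inv_into U1 \<kappa>1) y) = (f \<circ> inv_into U1 \<kappa>1) y"
        by (simp add: chart_inv[OF U1] chart_inv[OF U])
    qed
    then show "\<exists>T. open T \<and> x \<in> T \<and> smooth_on T (f \<circ> inv_into U1 \<kappa>1)"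
      using T q W'(2) by blast
  qed
  then show ?thesis using W unfolding smooth_fun_def by blast
qed

lemma smooth_fun_chartI:
  assumes "(U, \<kappa>) \<in> atlas M" "openin (topo M) W" "W \<subseteq> U" "smooth_on (\<kappa> ` W) (f \<circ> inv_into U \<kappa>)"
  shows "smooth_fun M W f"
  by (rule smooth_funI[OF assms(2)]) (use assms in blast)

lemma smooth_fun_subset:
  assumes "smooth_fun M W f" "openin (topo M) W'" "W' \<subseteq> W"
  shows "smooth_fun M W' f"
  unfolding smooth_fun_def using assms smooth_fun_chartD[OF assms(1)] by blast

lemma smooth_fun_cong:
  assumes "smooth_fun M W f" "\<And>q. q \<in> W \<Longrightarrow> f q = g q"
  shows "smooth_fun M W g"
proof -
  have W: "openin (topo M) W" using assms(1) by (rule smooth_fun_openin)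
  have "smooth_on (\<kappa> ` (U \<inter> W)) (g \<circ> inv_into U \<kappa>)" if U: "(U, \<kappa>) \<in> atlas M" for U \<kappa>
  proof (rule smooth_on_cong[OF _ _ smooth_fun_chartD[OF assms(1) U]])
    show "open (\<kappa> ` (U \<inter> W))" using open_chart_image[OF U openin_Int_chart[OF U W]] by blast
    show "(f \<circ> inv_into U \<kappa>) y = (g \<circ> inv_into U \<kappa>) y" if "y \<in> \<kappa> ` (U \<inter> W)" for y
      using that assms(2) by (auto simp: chart_inv[OF U])
  qed auto
  then show ?thesis using W unfolding smooth_fun_def by blast
qed

text \<open>Hands the proof the openness of the chart image, which the closure rules for
  \<open>smooth_on\<close> require.\<close>

lemma smooth_fun_lift:
  assumes "openin (topo M) W"
    and "\<And>U \<kappa>. (U, \<kappa>) \<in> atlas M \<Longrightarrow> open (\<kappa> ` (U \<inter> W)) \<Longrightarrow>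
      smooth_on (\<kappa> ` (U \<inter> W)) (f \<circ> inv_into U \<kappa>)"
  shows "smooth_fun M W f"
  unfolding smooth_fun_def
  using assms open_chart_image openin_Int_chart by (metis (no_types, lifting) Int_lower1 case_prodI2)

lemma smooth_fun_const: "openin (topo M) W \<Longrightarrow> smooth_fun M W (\<lambda>q. c)"
  by (rule smooth_fun_lift) (simp_all add: o_def smooth_on_const)

lemma smooth_fun_add:
  assumes "smooth_fun M W f" "smooth_fun M W g"
  shows "smooth_fun M W (\<lambda>q. f q + g q)"
  by (rule smooth_fun_lift[OF smooth_fun_openin[OF assms(1)]])
     (use smooth_on_add[OF _ smooth_fun_chartD[OF assms(1)] smooth_fun_chartD[OF assms(2)]] in \<open>simp add: o_def\<close>)

lemma smooth_fun_mult:
  assumes "smooth_fun M W f" "smooth_fun M W g"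
  shows "smooth_fun M W (\<lambda>q. f q * g q)"
  by (rule smooth_fun_lift[OF smooth_fun_openin[OF assms(1)]])
     (use smooth_on_mult[OF _ smooth_fun_chartD[OF assms(1)] smooth_fun_chartD[OF assms(2)]] in \<open>simp add: o_def\<close>)

lemma smooth_fun_minus: "smooth_fun M W f \<Longrightarrow> smooth_fun M W (\<lambda>q. - f q)"
  using smooth_fun_mult[OF smooth_fun_const[of W "- 1"], of f] smooth_fun_openin by auto

lemma smooth_fun_sum:
  assumes "openin (topo M) W" "\<And>i. i \<in> I \<Longrightarrow> smooth_fun M W (f i)"
  shows "smooth_fun M W (\<lambda>q. \<Sum>i\<in>I. f i q)"
  using assms(2)
  by (induction I rule: infinite_finite_induct) (auto simp: smooth_fun_const assms(1) smooth_fun_add)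

lemma smooth_fun_exp:
  assumes "smooth_fun M W f"
  shows "smooth_fun M W (\<lambda>q. exp (f q))"
  by (rule smooth_fun_lift[OF smooth_fun_openin[OF assms]])
     (use smooth_on_compose[OF _ open_UNIV _ smooth_on_exp smooth_fun_chartD[OF assms]] in \<open>simp add: o_def\<close>)

lemma smooth_fun_inverse:
  assumes "smooth_fun M W f" "\<And>q. q \<in> W \<Longrightarrow> f q \<noteq> 0"
  shows "smooth_fun M W (\<lambda>q. inverse (f q))"
proof (rule smooth_fun_lift[OF smooth_fun_openin[OF assms(1)]])
  fix U \<kappa> assume U: "(U, \<kappa>) \<in> atlas M" and o: "open (\<kappa> ` (U \<inter> W))"
  have "smooth_on (\<kappa> ` (U \<inter> W)) (\<lambda>x. inverse ((f \<circ> inv_into U \<kappa>) x))"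
    by (rule smooth_on_compose[OF o _ _ smooth_on_inverse smooth_fun_chartD[OF assms(1) U]])
       (use assms(2) in \<open>auto simp: chart_inv[OF U]\<close>)
  then show "smooth_on (\<kappa> ` (U \<inter> W)) ((\<lambda>q. inverse (f q)) \<circ> inv_into U \<kappa>)" by (simp add: o_def)
qed

lemma smooth_fun_coord:
  assumes "(U, \<kappa>) \<in> atlas M"
  shows "smooth_fun M U (\<lambda>q. \<kappa> q \<bullet> b)"
proof (rule smooth_fun_chartI[OF assms chart_openin[OF assms] order_refl])
  have o: "open (\<kappa> ` U)" using open_chart_image[OF assms chart_openin[OF assms]] by blast
  show "smooth_on (\<kappa> ` U) ((\<lambda>q. \<kappa> q \<bullet> b) \<circ> inv_into U \<kappa>)"
    by (rule smooth_on_cong[OF o _ smooth_on_inner[OF o smooth_on_ident[OF o], of b]])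
       (auto simp: chart_inv[OF assms])
qed

section \<open>Functions smooth near a point\<close>

lemma smooth_nearI: "smooth_fun M W f \<Longrightarrow> p \<in> W \<Longrightarrow> smooth_near M p f"
  unfolding smooth_near_def by blast

lemma smooth_near_common:
  assumes "smooth_near M p f" "openin (topo M) W" "p \<in> W"
  obtains W' where "smooth_fun M W' f" "p \<in> W'" "W' \<subseteq> W"
proof -
  obtain W1 where "smooth_fun M W1 f" "p \<in> W1" using assms(1) unfolding smooth_near_def by blast
  then show ?thesis
    using that[of "W1 \<inter> W"] smooth_fun_subset[of W1 f "W1 \<inter> W"] smooth_fun_openin assms(2,3)
    by (simp add: openin_Int)
qed

lemma smooth_near_cong:
  assumes "openin (topo M) W" "p \<in> W" "\<And>q. q \<in> W \<Longrightarrow> f q = g q" "smooth_near M p f"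
  shows "smooth_near M p g"
  using smooth_near_common[OF assms(4,1,2)] smooth_fun_cong smooth_nearI assms(3)
  by (metis (no_types, lifting) in_mono)

lemma smooth_near_add: "smooth_near M p f \<Longrightarrow> smooth_near M p g \<Longrightarrow> smooth_near M p (\<lambda>q. f q + g q)"
  by (metis smooth_near_common smooth_near_def smooth_fun_add smooth_fun_openin smooth_fun_subset)

lemma smooth_near_mult: "smooth_near M p f \<Longrightarrow> smooth_near M p g \<Longrightarrow> smooth_near M p (\<lambda>q. f q * g q)"
  by (metis smooth_near_common smooth_near_def smooth_fun_mult smooth_fun_openin smooth_fun_subset)

lemma smooth_near_const: "p \<in> points M \<Longrightarrow> smooth_near M p (\<lambda>q. c)"
  unfolding smooth_near_def points_def using smooth_fun_const by blast

lemma smooth_near_exp: "smooth_near M p f \<Longrightarrow> smooth_near M p (\<lambda>q. exp (f q))"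
  unfolding smooth_near_def using smooth_fun_exp by blast

lemma smooth_near_has_derivative:
  assumes "(U, \<kappa>) \<in> atlas M" "p \<in> U" "smooth_near M p f"
  shows "((f \<circ> inv_into U \<kappa>) has_derivative frechet_derivative (f \<circ> inv_into U \<kappa>) (at (\<kappa> p))) (at (\<kappa> p))"
proof -
  obtain W where W: "smooth_fun M W f" "p \<in> W" "W \<subseteq> U"
    using smooth_near_common[OF assms(3) chart_openin[OF assms(1)] assms(2)] by blast
  show ?thesis
    by (rule smooth_on_has_derivative[OF smooth_fun_chartD[OF W(1) assms(1), of W]]) (use W in auto)
qed

section \<open>Tangent vectors in coordinates\<close>

lemma chart_vec_eq:
  assumes "(U, \<kappa>) \<in> atlas M" "p \<in> U" "smooth_near M p f"
    and "((f \<circ> inv_into U \<kappa>) has_derivative D) (at (\<kappa> p))"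
  shows "chart_vec M U \<kappa> p u f = D u"
  using assms(3) frechet_derivative_at[OF assms(4)] by (simp add: chart_vec_def)

lemma chart_vec_has_derivative:
  assumes "(U, \<kappa>) \<in> atlas M" "p \<in> U" "smooth_near M p f"
  shows "((f \<circ> inv_into U \<kappa>) has_derivative (\<lambda>u. chart_vec M U \<kappa> p u f)) (at (\<kappa> p))"
  using smooth_near_has_derivative[OF assms] assms(3) by (simp add: chart_vec_def)

lemma chart_vec_not_smooth: "\<not> smooth_near M p f \<Longrightarrow> chart_vec M U \<kappa> p u f = 0"
  by (simp add: chart_vec_def)

text \<open>The Jacobian of the transition map at \<open>p\<close> carries \<open>u\<close> to
  \<open>u'\<close>; the chain rule compares the two operators function by function.\<close>

lemma chart_vec_change:
  assumes U: "(U, \<kappa>) \<in> atlas M" "p \<in> U" and U1: "(U1, \<kappa>1) \<in> atlas M" "p \<in> U1"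
  shows "\<exists>u'. chart_vec M U1 \<kappa>1 p u = chart_vec M U \<kappa> p u'"
proof -
  let ?\<tau> = "\<kappa> \<circ> inv_into U1 \<kappa>1"
  let ?D = "frechet_derivative ?\<tau> (at (\<kappa>1 p))"
  have \<tau>: "(?\<tau> has_derivative ?D) (at (\<kappa>1 p))"
    by (rule smooth_on_has_derivative[OF chart_transition[OF U1(1) U(1)]]) (use U U1 in auto)
  have "chart_vec M U1 \<kappa>1 p u f = chart_vec M U \<kappa> p (?D u) f" for f
  proof (cases "smooth_near M p f")
    case True
    have "(f \<circ> inv_into U \<kappa> has_derivative (\<lambda>u. chart_vec M U \<kappa> p u f)) (at (?\<tau> (\<kappa>1 p)))"
      using chart_vec_has_derivative[OF U True] by (simp add: chart_inv[OF U1])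
    from diff_chain_at[OF \<tau> this]
    have "((f \<circ> inv_into U \<kappa>) \<circ> ?\<tau> has_derivative (\<lambda>u. chart_vec M U \<kappa> p (?D u) f)) (at (\<kappa>1 p))"
      by (simp add: o_def)
    then have "(f \<circ> inv_into U1 \<kappa>1 has_derivative (\<lambda>u. chart_vec M U \<kappa> p (?D u) f)) (at (\<kappa>1 p))"
      by (rule has_derivative_transform_within_open[of _ _ _ _ "\<kappa>1 ` (U1 \<inter> U)"])
         (use U U1 open_chart_image[OF U1(1) openin_Int_chart[OF U1(1) chart_openin[OF U(1)]]]
          in \<open>auto simp: chart_inv[OF U1(1)] chart_inv[OF U(1)]\<close>)
    then show ?thesis by (rule chart_vec_eq[OF U1 True])
  qed (simp add: chart_vec_not_smooth)
  then show ?thesis by (intro exI[of _ "?D u"]) auto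
qed

lemma tangent_space_chart:
  assumes "(U, \<kappa>) \<in> atlas M" "p \<in> U"
  shows "tangent_space M p = range (chart_vec M U \<kappa> p)"
proof -
  have "tangent_space M p = {v. \<exists>(U1, \<kappa>1)\<in>atlas M. p \<in> U1 \<and> (\<exists>u. v = chart_vec M U1 \<kappa>1 p u)}"
    unfolding tangent_space_def chart_vec_def ..
  also have "\<dots> = range (chart_vec M U \<kappa> p)"
    using chart_vec_change[OF assms] assms by fastforce
  finally show ?thesis .
qed

lemma chart_vec_linear:
  assumes "(U, \<kappa>) \<in> atlas M" "p \<in> U"
  shows "linear (chart_vec M U \<kappa> p)"
proof -
  have lin: "linear (\<lambda>u. chart_vec M U \<kappa> p u f)" if "smooth_near M p f" for f
    using has_derivative_linear[OF chart_vec_has_derivative[OF assms that]] .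
  show ?thesis
  proof (rule linearI; rule ext)
    show "chart_vec M U \<kappa> p (u + w) f = (chart_vec M U \<kappa> p u + chart_vec M U \<kappa> p w) f" for u w f
      using linear_add[OF lin] by (cases "smooth_near M p f") (auto simp: chart_vec_not_smooth)
    show "chart_vec M U \<kappa> p (r *\<^sub>R u) f = (r *\<^sub>R chart_vec M U \<kappa> p u) f" for r u f
      using linear_scale[OF lin] by (cases "smooth_near M p f") (auto simp: chart_vec_not_smooth)
  qed
qed

lemma subspace_tangent_space:
  assumes "p \<in> points M" shows "subspace (tangent_space M p)"
proof -
  obtain U \<kappa> where U: "(U, \<kappa>) \<in> atlas M" "p \<in> U" using chart_at[OF assms] .
  show ?thesis unfolding tangent_space_chart[OF U]
    using linear_subspace_image[OF chart_vec_linear[OF U] subspace_UNIV] .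
qed

lemma tangent_space_obtain_chart:
  assumes "v \<in> tangent_space M p"
  obtains U \<kappa> u where "(U, \<kappa>) \<in> atlas M" "p \<in> U" "v = chart_vec M U \<kappa> p u"
  using assms unfolding tangent_space_def chart_vec_def by blast

section \<open>Tangent vectors as derivations\<close>

lemma tangent_not_smooth: "v \<in> tangent_space M p \<Longrightarrow> \<not> smooth_near M p f \<Longrightarrow> v f = 0"
  using tangent_space_obtain_chart chart_vec_not_smooth by metis

lemma tangent_add:
  assumes "v \<in> tangent_space M p" "smooth_near M p f" "smooth_near M p g"
  shows "v (\<lambda>q. f q + g q) = v f + v g"
proof -
  obtain U \<kappa> u where U: "(U, \<kappa>) \<in> atlas M" "p \<in> U" "v = chart_vec M U \<kappa> p u"
    using tangent_space_obtain_chart[OF assms(1)] .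
  show ?thesis unfolding U(3)
    by (rule chart_vec_eq[OF U(1,2) smooth_near_add[OF assms(2,3)]])
       (use has_derivative_add[OF chart_vec_has_derivative[OF U(1,2) assms(2)]
          chart_vec_has_derivative[OF U(1,2) assms(3)]] in \<open>simp add: o_def\<close>)
qed

lemma tangent_mult:
  assumes "v \<in> tangent_space M p" "smooth_near M p f" "smooth_near M p g"
  shows "v (\<lambda>q. f q * g q) = v f * g p + f p * v g"
proof -
  obtain U \<kappa> u where U: "(U, \<kappa>) \<in> atlas M" "p \<in> U" "v = chart_vec M U \<kappa> p u"
    using tangent_space_obtain_chart[OF assms(1)] .
  show ?thesis unfolding U(3)
    by (rule chart_vec_eq[OF U(1,2) smooth_near_mult[OF assms(2,3)]])
       (use has_derivative_mult[OF chart_vec_has_derivative[OF U(1,2) assms(2)]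
          chart_vec_has_derivative[OF U(1,2) assms(3)]]
        in \<open>simp add: o_def chart_inv[OF U(1,2)] add.commute\<close>)
qed

lemma tangent_exp:
  assumes "v \<in> tangent_space M p" "smooth_near M p f"
  shows "v (\<lambda>q. exp (f q)) = exp (f p) * v f"
proof -
  obtain U \<kappa> u where U: "(U, \<kappa>) \<in> atlas M" "p \<in> U" "v = chart_vec M U \<kappa> p u"
    using tangent_space_obtain_chart[OF assms(1)] .
  have e: "(exp has_derivative (*) (exp (f p))) (at ((f \<circ> inv_into U \<kappa>) (\<kappa> p)))"
    using DERIV_exp[of "f p"] by (simp add: has_field_derivative_def chart_inv[OF U(1,2)])
  show ?thesis unfolding U(3)
    by (rule chart_vec_eq[OF U(1,2) smooth_near_exp[OF assms(2)]])
       (use diff_chain_at[OF chart_vec_has_derivative[OF U(1,2) assms(2)] e] in \<open>simp add: o_def\<close>)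
qed

lemma tangent_const:
  assumes "v \<in> tangent_space M p" "p \<in> points M"
  shows "v (\<lambda>q. c) = 0"
proof -
  obtain U \<kappa> u where U: "(U, \<kappa>) \<in> atlas M" "p \<in> U" "v = chart_vec M U \<kappa> p u"
    using tangent_space_obtain_chart[OF assms(1)] .
  show ?thesis unfolding U(3)
    by (rule chart_vec_eq[OF U(1,2) smooth_near_const[OF assms(2)]]) (simp add: o_def)
qed

text \<open>Locality of tangent vectors. For functions that are not smooth near \<open>p\<close> the
  extension by 0 makes both sides 0, so the rule can be applied to component functions before their
  smoothness is known.\<close>

lemma tangent_cong:
  assumes "v \<in> tangent_space M p" "openin (topo M) W" "p \<in> W" "\<And>q. q \<in> W \<Longrightarrow> f q = g q"
  shows "v f = v g"
proof (cases "smooth_near M p f")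
  case True
  then have g: "smooth_near M p g" using smooth_near_cong[OF assms(2,3), of f g] assms(4) by auto
  obtain U \<kappa> u where U: "(U, \<kappa>) \<in> atlas M" "p \<in> U" "v = chart_vec M U \<kappa> p u"
    using tangent_space_obtain_chart[OF assms(1)] .
  have "((f \<circ> inv_into U \<kappa>) has_derivative (\<lambda>u. chart_vec M U \<kappa> p u g)) (at (\<kappa> p))"
    by (rule has_derivative_transform_within_open[OF chart_vec_has_derivative[OF U(1,2) g],
          of "\<kappa> ` (U \<inter> W)"])
       (use open_chart_image[OF U(1) openin_Int_chart[OF U(1) assms(2)]] U assms(3,4)
        in \<open>auto simp: chart_inv[OF U(1)]\<close>)
  then show ?thesis unfolding U(3) by (rule chart_vec_eq[OF U(1,2) True])
next
  case False
  then have "\<not> smooth_near M p g" using smooth_near_cong[OF assms(2,3), of g f] assms(4) by auto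
  then show ?thesis using tangent_not_smooth[OF assms(1)] False by simp
qed

text \<open>The two claims are proved together because adding one summand needs smoothness of the
  partial sum.\<close>

lemma tangent_sum:
  assumes "v \<in> tangent_space M p" "p \<in> points M" "\<And>i. i \<in> I \<Longrightarrow> smooth_near M p (f i)"
  shows "smooth_near M p (\<lambda>q. \<Sum>i\<in>I. f i q) \<and> v (\<lambda>q. \<Sum>i\<in>I. f i q) = (\<Sum>i\<in>I. v (f i))"
  using assms(3)
  by (induction I rule: infinite_finite_induct)
     (auto simp: tangent_const[OF assms(1,2)] smooth_near_const[OF assms(2)] smooth_near_add tangent_add[OF assms(1)])

lemma chart_vec_coord:
  assumes "(U, \<kappa>) \<in> atlas M" "p \<in> U"
  shows "chart_vec M U \<kappa> p u (\<lambda>q. \<kappa> q \<bullet> b) = u \<bullet> b"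
proof (rule chart_vec_eq[OF assms smooth_nearI[OF smooth_fun_coord[OF assms(1)] assms(2)]])
  have "((\<lambda>y. y \<bullet> b) has_derivative (\<lambda>u. u \<bullet> b)) (at (\<kappa> p))"
    by (auto intro!: derivative_eq_intros)
  then show "((\<lambda>q. \<kappa> q \<bullet> b) \<circ> inv_into U \<kappa> has_derivative (\<lambda>u. u \<bullet> b)) (at (\<kappa> p))"
    by (rule has_derivative_transform_within_open[of _ _ _ _ "\<kappa> ` U"])
       (use assms open_chart_image[OF assms(1) chart_openin[OF assms(1)]] in \<open>auto simp: chart_inv[OF assms(1)]\<close>)
qed

lemma chart_vec_tangent: "(U, \<kappa>) \<in> atlas M \<Longrightarrow> p \<in> U \<Longrightarrow> chart_vec M U \<kappa> p u \<in> tangent_space M p"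
  using tangent_space_chart by blast

lemma tangent_expand:
  assumes "(U, \<kappa>) \<in> atlas M" "p \<in> U" "v \<in> tangent_space M p"
  shows "v = (\<Sum>b\<in>Basis. v (\<lambda>q. \<kappa> q \<bullet> b) *\<^sub>R chart_vec M U \<kappa> p b)"
proof -
  obtain u where u: "v = chart_vec M U \<kappa> p u" using assms tangent_space_chart by blast
  have "chart_vec M U \<kappa> p (\<Sum>b\<in>Basis. (u \<bullet> b) *\<^sub>R b) = (\<Sum>b\<in>Basis. (u \<bullet> b) *\<^sub>R chart_vec M U \<kappa> p b)"
    using chart_vec_linear[OF assms(1,2)] by (simp add: linear_sum linear_scale)
  then show ?thesis unfolding u chart_vec_coord[OF assms(1,2)] by (simp add: euclidean_representation)
qed

section \<open>Smooth vector fields\<close>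

lemma smooth_vf_openin: "smooth_vf M W X \<Longrightarrow> openin (topo M) W"
  by (simp add: smooth_vf_def)

lemma smooth_vf_tangent: "smooth_vf M W X \<Longrightarrow> q \<in> W \<Longrightarrow> X q \<in> tangent_space M q"
  by (simp add: smooth_vf_def)

lemma smooth_vf_points: "smooth_vf M W X \<Longrightarrow> q \<in> W \<Longrightarrow> q \<in> points M"
  using smooth_vf_openin openin_subset unfolding points_def by blast

lemma smooth_vf_fun: "smooth_vf M W X \<Longrightarrow> smooth_fun M V f \<Longrightarrow> V \<subseteq> W \<Longrightarrow> smooth_fun M V (\<lambda>p. X p f)"
  by (simp add: smooth_vf_def)

lemma smooth_vf_subset: "smooth_vf M W X \<Longrightarrow> openin (topo M) W' \<Longrightarrow> W' \<subseteq> W \<Longrightarrow> smooth_vf M W' X"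
  unfolding smooth_vf_def by (meson order_trans subsetD)

lemma smooth_vf_cong:
  assumes "smooth_vf M W X" "\<And>q. q \<in> W \<Longrightarrow> X q = Y q"
  shows "smooth_vf M W Y"
  unfolding smooth_vf_def
proof (intro conjI allI ballI impI)
  show "openin (topo M) W" using smooth_vf_openin[OF assms(1)] .
  show "Y q \<in> tangent_space M q" if "q \<in> W" for q
    using smooth_vf_tangent[OF assms(1) that] assms(2)[OF that] by simp
  show "smooth_fun M V (\<lambda>p. Y p f)" if "V \<subseteq> W" "smooth_fun M V f" for V f
    by (rule smooth_fun_cong[OF smooth_vf_fun[OF assms(1) that(2,1)]]) (use that assms(2) in auto)
qed

lemma smooth_vf_zero:
  assumes "openin (topo M) W"
  shows "smooth_vf M W (\<lambda>q. 0)"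
  unfolding smooth_vf_def
proof (intro conjI allI ballI impI)
  show "openin (topo M) W" by fact
  show "0 \<in> tangent_space M q" if "q \<in> W" for q
    using that openin_subset[OF assms] subspace_0[OF subspace_tangent_space] by (auto simp: points_def)
  show "smooth_fun M V (\<lambda>p. 0 f)" if "smooth_fun M V f" for V f
    using smooth_fun_const[OF smooth_fun_openin[OF that], of 0] by simp
qed

lemma smooth_vf_add:
  assumes "smooth_vf M W X" "smooth_vf M W Y"
  shows "smooth_vf M W (\<lambda>q. X q + Y q)"
  unfolding smooth_vf_def
proof (intro conjI allI ballI impI)
  show "openin (topo M) W" using smooth_vf_openin[OF assms(1)] .
  show "X q + Y q \<in> tangent_space M q" if "q \<in> W" for q
    using smooth_vf_tangent[OF _ that] smooth_vf_points[OF _ that] assms subspace_tangent_space subspace_add by blast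
  show "smooth_fun M V (\<lambda>p. (X p + Y p) f)" if "V \<subseteq> W" "smooth_fun M V f" for V f
    using smooth_fun_add[OF smooth_vf_fun[OF assms(1) that(2,1)] smooth_vf_fun[OF assms(2) that(2,1)]] by simp
qed

lemma smooth_vf_scale:
  assumes "smooth_fun M W h" "smooth_vf M W X"
  shows "smooth_vf M W (\<lambda>q. h q *\<^sub>R X q)"
  unfolding smooth_vf_def
proof (intro conjI allI ballI impI)
  show W: "openin (topo M) W" using smooth_vf_openin[OF assms(2)] .
  show "h q *\<^sub>R X q \<in> tangent_space M q" if "q \<in> W" for q
    using smooth_vf_tangent[OF _ that] smooth_vf_points[OF _ that] assms subspace_tangent_space subspace_scale by blast
  show "smooth_fun M V (\<lambda>p. (h p *\<^sub>R X p) f)" if "V \<subseteq> W" "smooth_fun M V f" for V f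
    using smooth_fun_mult[OF smooth_fun_subset[OF assms(1) smooth_fun_openin[OF that(2)] that(1)]
        smooth_vf_fun[OF assms(2) that(2,1)]] by simp
qed

lemma smooth_vf_sum:
  assumes "openin (topo M) W" "\<And>i. i \<in> I \<Longrightarrow> smooth_vf M W (X i)"
  shows "smooth_vf M W (\<lambda>q. \<Sum>i\<in>I. X i q)"
  using assms(2)
  by (induction I rule: infinite_finite_induct) (auto simp: smooth_vf_zero assms(1) smooth_vf_add)

lemma smooth_vf_chart_vec:
  assumes U: "(U, \<kappa>) \<in> atlas M"
  shows "smooth_vf M U (\<lambda>q. chart_vec M U \<kappa> q u)"
  unfolding smooth_vf_def
proof (intro conjI allI ballI impI)
  show "openin (topo M) U" using chart_openin[OF U] .
  show "chart_vec M U \<kappa> q u \<in> tangent_space M q" if "q \<in> U" for q using chart_vec_tangent[OF U that] .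
  show "smooth_fun M V (\<lambda>p. chart_vec M U \<kappa> p u f)" if V: "V \<subseteq> U" "smooth_fun M V f" for V f
  proof (rule smooth_fun_chartI[OF U smooth_fun_openin[OF V(2)] V(1)])
    show "smooth_on (\<kappa> ` V) ((\<lambda>p. chart_vec M U \<kappa> p u f) \<circ> inv_into U \<kappa>)"
    proof (rule smooth_on_cong[OF _ _ smooth_on_frechet[OF smooth_fun_chartD[OF V(2) U]]])
      show "open (\<kappa> ` V)" using open_chart_image[OF U smooth_fun_openin[OF V(2)] V(1)] .
      show "V \<subseteq> U \<inter> V" using V by auto
      show "frechet_derivative (f \<circ> inv_into U \<kappa>) (at x) u = ((\<lambda>p. chart_vec M U \<kappa> p u f) \<circ> inv_into U \<kappa>) x"
        if "x \<in> \<kappa> ` V" for x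
        using that V smooth_nearI[OF V(2)] by (auto simp: chart_vec_def chart_inv[OF U])
    qed
  qed
qed

lemma smooth_vf_coord:
  assumes "(U, \<kappa>) \<in> atlas M" "smooth_vf M W X" "W \<subseteq> U"
  shows "smooth_fun M W (\<lambda>q. X q (\<lambda>r. \<kappa> r \<bullet> b))"
  using smooth_vf_fun[OF assms(2) smooth_fun_subset[OF smooth_fun_coord[OF assms(1)] smooth_vf_openin[OF assms(2)] assms(3)]]
  by simp

text \<open>The extension has constant coefficients in the coordinate frame and lives on the chart
  domain only, so no cut-off function is involved.\<close>

lemma tangent_extend:
  assumes "(U, \<kappa>) \<in> atlas M" "p \<in> U" "v \<in> tangent_space M p"
  obtains X where "smooth_vf M U X" "X p = v"
proof -
  obtain u where "v = chart_vec M U \<kappa> p u" using assms tangent_space_chart by blast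
  then show ?thesis using that[OF smooth_vf_chart_vec[OF assms(1), of u]] by simp
qed

end

section \<open>Connections, metrics and conformal change\<close>

text \<open>Alternating the two symmetries, three times each, brings the arguments back to their
  original order with a minus sign. This is the algebra behind uniqueness of the Levi-Civita
  connection; in its applications \<open>C\<close> consists of the smooth fields.\<close>

lemma symmetric_skew_zero:
  fixes B :: "'v \<Rightarrow> 'v \<Rightarrow> 'v \<Rightarrow> real"
  assumes "\<And>X Y Z. X \<in> C \<Longrightarrow> Y \<in> C \<Longrightarrow> Z \<in> C \<Longrightarrow> B X Y Z = B Y X Z"
    and "\<And>X Y Z. X \<in> C \<Longrightarrow> Y \<in> C \<Longrightarrow> Z \<in> C \<Longrightarrow> B X Y Z = - B X Z Y"
    and "X \<in> C" "Y \<in> C" "Z \<in> C"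
  shows "B X Y Z = 0"
proof -
  have "B X Y Z = - B Y Z X" using assms by metis
  also have "\<dots> = B Z X Y" using assms by (metis minus_minus)
  also have "\<dots> = - B X Y Z" using assms by metis
  finally show ?thesis by simp
qed

context smooth_mfd
begin

lemma smooth_fun_local:
  assumes "\<And>p. p \<in> W \<Longrightarrow> \<exists>W'. p \<in> W' \<and> W' \<subseteq> W \<and> smooth_fun M W' f"
  shows "smooth_fun M W f"
proof (rule smooth_funI)
  show "openin (topo M) W" by (subst openin_subopen) (use assms smooth_fun_openin in blast)
  fix p assume "p \<in> W"
  then obtain W' where W': "p \<in> W'" "W' \<subseteq> W" "smooth_fun M W' f" using assms by blast
  have o: "openin (topo M) W'" using smooth_fun_openin[OF W'(3)] .
  then have "p \<in> points M" using W'(1) openin_subset unfolding points_def by blast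
  then obtain U \<kappa> where U: "(U, \<kappa>) \<in> atlas M" "p \<in> U" using chart_at by blast
  have "smooth_on (\<kappa> ` (U \<inter> W')) (f \<circ> inv_into U \<kappa>)" by (rule smooth_fun_chartD[OF W'(3) U(1)]) simp
  moreover have "openin (topo M) (U \<inter> W')" using openin_Int_chart[OF U(1) o] .
  ultimately show "\<exists>U \<kappa> W'. (U, \<kappa>) \<in> atlas M \<and> openin (topo M) W' \<and> p \<in> W' \<and> W' \<subseteq> U \<inter> W \<and>
      smooth_on (\<kappa> ` W') (f \<circ> inv_into U \<kappa>)"
    using U W' by blast
qed

section \<open>Calculus of an affine connection\<close>

context
  fixes nabla :: "'a connection"
  assumes conn: "affine_connection M nabla"
begin

lemma nabla_tangent: "smooth_vf M W Y \<Longrightarrow> p \<in> W \<Longrightarrow> v \<in> tangent_space M p \<Longrightarrow> nabla p v Y \<in> tangent_space M p"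
  by (rule conn[unfolded affine_connection_def, THEN conjunct1, rule_format, THEN conjunct1, rule_format])

lemma nabla_linear: "smooth_vf M W Y \<Longrightarrow> p \<in> W \<Longrightarrow> linear_map_on (tangent_space M p) (\<lambda>v. nabla p v Y)"
  by (rule conn[unfolded affine_connection_def, THEN conjunct1, rule_format, THEN conjunct2])

lemma nabla_add:
  "smooth_vf M W Y \<Longrightarrow> smooth_vf M W Z \<Longrightarrow> p \<in> W \<Longrightarrow> v \<in> tangent_space M p \<Longrightarrow>
    nabla p v (\<lambda>q. Y q + Z q) = nabla p v Y + nabla p v Z"
  by (rule conn[unfolded affine_connection_def, THEN conjunct2, THEN conjunct1, rule_format])

lemma nabla_leibniz:
  "smooth_fun M W h \<Longrightarrow> smooth_vf M W Y \<Longrightarrow> p \<in> W \<Longrightarrow> v \<in> tangent_space M p \<Longrightarrow>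
    nabla p v (\<lambda>q. h q *\<^sub>R Y q) = v h *\<^sub>R Y p + h p *\<^sub>R nabla p v Y"
  by (rule conn[unfolded affine_connection_def, THEN conjunct2, THEN conjunct2, THEN conjunct1, rule_format])

lemma nabla_cong:
  assumes Y: "smooth_vf M W Y" and eq: "\<And>q. q \<in> W \<Longrightarrow> Y q = Z q" and p: "p \<in> W"
    and v: "v \<in> tangent_space M p"
  shows "nabla p v Y = nabla p v Z"
proof -
  \<comment> \<open>The indicator of \<open>W\<close> is 1 on a neighbourhood of \<open>p\<close>,
    and multiplication by it makes \<open>Y\<close> and \<open>Z\<close> equal as functions
    everywhere. The Leibniz rule then removes it again on either side.\<close>
  define h where "h q = (if q \<in> W then 1 else 0 :: real)" for q
  have W: "openin (topo M) W" using smooth_vf_openin[OF Y] .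
  have h: "smooth_fun M W h" by (rule smooth_fun_cong[OF smooth_fun_const[OF W, of 1]]) (simp add: h_def)
  have "v h = v (\<lambda>q. 1)" by (rule tangent_cong[OF v W p]) (simp add: h_def)
  then have vh: "v h = 0" using tangent_const[OF v smooth_vf_points[OF Y p]] by simp
  have Z: "smooth_vf M W Z" using smooth_vf_cong[OF Y] eq by blast
  have "nabla p v Y = nabla p v (\<lambda>q. h q *\<^sub>R Y q)"
    using nabla_leibniz[OF h Y p v] vh p by (simp add: h_def)
  also have "(\<lambda>q. h q *\<^sub>R Y q) = (\<lambda>q. h q *\<^sub>R Z q)" using eq by (auto simp: h_def)
  also have "nabla p v \<dots> = nabla p v Z"
    using nabla_leibniz[OF h Z p v] vh p by (simp add: h_def)
  finally show ?thesis .
qed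

lemma nabla_zero:
  assumes "p \<in> points M" "v \<in> tangent_space M p"
  shows "nabla p v (\<lambda>q. 0) = 0"
proof -
  have o: "openin (topo M) (points M)" by (simp add: points_def)
  show ?thesis using nabla_leibniz[OF smooth_fun_const[OF o, of 0] smooth_vf_zero[OF o] assms] by simp
qed

lemma nabla_scale:
  assumes "smooth_vf M W Y" "p \<in> W" "v \<in> tangent_space M p"
  shows "nabla p v (\<lambda>q. a *\<^sub>R Y q) = a *\<^sub>R nabla p v Y"
  using nabla_leibniz[OF smooth_fun_const[OF smooth_vf_openin[OF assms(1)], of a] assms]
    tangent_const[OF assms(3) smooth_vf_points[OF assms(1,2)]] by simp

lemma nabla_sum:
  assumes p: "p \<in> W" and v: "v \<in> tangent_space M p" and W: "openin (topo M) W"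
    and c: "\<And>i. i \<in> I \<Longrightarrow> smooth_fun M W (c i)" and E: "\<And>i. i \<in> I \<Longrightarrow> smooth_vf M W (E i)"
  shows "nabla p v (\<lambda>q. \<Sum>i\<in>I. c i q *\<^sub>R E i q) = (\<Sum>i\<in>I. v (c i) *\<^sub>R E i p + c i p *\<^sub>R nabla p v (E i))"
proof -
  have pM: "p \<in> points M" using p openin_subset[OF W] by (auto simp: points_def)
  show ?thesis using c E
  proof (induction I rule: infinite_finite_induct)
    case (insert i I)
    have s: "smooth_vf M W (\<lambda>q. \<Sum>i\<in>I. c i q *\<^sub>R E i q)"
      using insert.prems by (intro smooth_vf_sum W smooth_vf_scale) auto
    have ci: "smooth_fun M W (c i)" and Ei: "smooth_vf M W (E i)" using insert.prems by auto
    have IH: "nabla p v (\<lambda>q. \<Sum>i\<in>I. c i q *\<^sub>R E i q) = (\<Sum>i\<in>I. v (c i) *\<^sub>R E i p + c i p *\<^sub>R nabla p v (E i))"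
      using insert.prems by (intro insert.IH) auto
    show ?case
      unfolding sum.insert[OF insert.hyps] nabla_add[OF smooth_vf_scale[OF ci Ei] s p v]
        nabla_leibniz[OF ci Ei p v] IH ..
  qed (simp_all add: nabla_zero[OF pM v])
qed

end
end

section \<open>Metric algebra, and smoothness tested by the metric\<close>

locale riemannian_mfd = smooth_mfd +
  fixes g :: "'a \<Rightarrow> 'a tvec \<Rightarrow> 'a tvec \<Rightarrow> real"
  assumes riemannian: "riemannian_metric M g"
begin

lemma metric_linear: "p \<in> points M \<Longrightarrow> v \<in> tangent_space M p \<Longrightarrow> linear_map_on (tangent_space M p) (g p v)"
  by (rule riemannian[unfolded riemannian_metric_def, THEN conjunct1, rule_format])

lemma metric_sym: "p \<in> points M \<Longrightarrow> v \<in> tangent_space M p \<Longrightarrow> w \<in> tangent_space M p \<Longrightarrow> g p v w = g p w v"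
  by (rule riemannian[unfolded riemannian_metric_def, THEN conjunct2, THEN conjunct1, rule_format])

lemma metric_pos: "p \<in> points M \<Longrightarrow> v \<in> tangent_space M p \<Longrightarrow> v \<noteq> 0 \<Longrightarrow> g p v v > 0"
  by (rule riemannian[unfolded riemannian_metric_def, THEN conjunct2, THEN conjunct2, THEN conjunct1, rule_format])

lemma metric_smooth: "smooth_vf M W X \<Longrightarrow> smooth_vf M W Y \<Longrightarrow> smooth_fun M W (\<lambda>p. g p (X p) (Y p))"
  by (rule riemannian[unfolded riemannian_metric_def, THEN conjunct2, THEN conjunct2, THEN conjunct2, rule_format])

lemma metric_add_right:
  "p \<in> points M \<Longrightarrow> v \<in> tangent_space M p \<Longrightarrow> w \<in> tangent_space M p \<Longrightarrow> u \<in> tangent_space M p \<Longrightarrow>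
    g p v (w + u) = g p v w + g p v u"
  using metric_linear linear_map_on_add by blast

lemma metric_scale_right:
  "p \<in> points M \<Longrightarrow> v \<in> tangent_space M p \<Longrightarrow> w \<in> tangent_space M p \<Longrightarrow> g p v (a *\<^sub>R w) = a * g p v w"
  using metric_linear linear_map_on_scaleR by (metis real_scaleR_def)

lemma tangent_add_mem: "p \<in> points M \<Longrightarrow> v \<in> tangent_space M p \<Longrightarrow> w \<in> tangent_space M p \<Longrightarrow> v + w \<in> tangent_space M p"
  using subspace_tangent_space subspace_add by blast

lemma tangent_scale_mem: "p \<in> points M \<Longrightarrow> v \<in> tangent_space M p \<Longrightarrow> a *\<^sub>R v \<in> tangent_space M p"
  using subspace_tangent_space subspace_scale by blast

lemma tangent_diff_mem: "p \<in> points M \<Longrightarrow> v \<in> tangent_space M p \<Longrightarrow> w \<in> tangent_space M p \<Longrightarrow> v - w \<in> tangent_space M p"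
  using subspace_tangent_space subspace_diff by blast

lemma tangent_sum_mem: "p \<in> points M \<Longrightarrow> (\<And>i. i \<in> I \<Longrightarrow> v i \<in> tangent_space M p) \<Longrightarrow> sum v I \<in> tangent_space M p"
  using subspace_tangent_space subspace_sum by blast

lemma metric_add_left:
  "p \<in> points M \<Longrightarrow> v \<in> tangent_space M p \<Longrightarrow> w \<in> tangent_space M p \<Longrightarrow> u \<in> tangent_space M p \<Longrightarrow>
    g p (v + w) u = g p v u + g p w u"
  by (simp add: metric_sym[of p _ u] tangent_add_mem metric_add_right)

lemma metric_scale_left:
  "p \<in> points M \<Longrightarrow> v \<in> tangent_space M p \<Longrightarrow> w \<in> tangent_space M p \<Longrightarrow> g p (a *\<^sub>R v) w = a * g p v w"
  by (simp add: metric_sym[of p _ w] tangent_scale_mem metric_scale_right)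

lemma metric_diff_right:
  "p \<in> points M \<Longrightarrow> v \<in> tangent_space M p \<Longrightarrow> w \<in> tangent_space M p \<Longrightarrow> u \<in> tangent_space M p \<Longrightarrow>
    g p v (w - u) = g p v w - g p v u"
  using metric_add_right[of p v w "(-1) *\<^sub>R u"] metric_scale_right[of p v u "-1"] tangent_scale_mem[of p u "-1"]
  by simp

lemma metric_diff_left:
  "p \<in> points M \<Longrightarrow> v \<in> tangent_space M p \<Longrightarrow> w \<in> tangent_space M p \<Longrightarrow> u \<in> tangent_space M p \<Longrightarrow>
    g p (v - w) u = g p v u - g p w u"
  by (simp add: metric_sym[of p _ u] tangent_diff_mem metric_diff_right)

lemma metric_minus_left:
  "p \<in> points M \<Longrightarrow> v \<in> tangent_space M p \<Longrightarrow> w \<in> tangent_space M p \<Longrightarrow> g p (- v) w = - g p v w"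
  using metric_scale_left[of p v w "-1"] by simp

lemma metric_zero: "p \<in> points M \<Longrightarrow> v \<in> tangent_space M p \<Longrightarrow> g p v 0 = 0"
  using metric_scale_right[of p v v 0] by simp

lemma metric_sum_right:
  "p \<in> points M \<Longrightarrow> v \<in> tangent_space M p \<Longrightarrow> (\<And>i. i \<in> I \<Longrightarrow> w i \<in> tangent_space M p) \<Longrightarrow>
    g p v (\<Sum>i\<in>I. c i *\<^sub>R w i) = (\<Sum>i\<in>I. c i * g p v (w i))"
  using linear_map_on_sum[OF metric_linear subspace_tangent_space] by (metis (no_types, lifting) real_scaleR_def sum.cong)

lemma metric_sum_left:
  assumes "p \<in> points M" "v \<in> tangent_space M p" "\<And>i. i \<in> I \<Longrightarrow> w i \<in> tangent_space M p"
  shows "g p (\<Sum>i\<in>I. c i *\<^sub>R w i) v = (\<Sum>i\<in>I. c i * g p (w i) v)"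
proof -
  have "g p (\<Sum>i\<in>I. c i *\<^sub>R w i) v = g p v (\<Sum>i\<in>I. c i *\<^sub>R w i)"
    by (rule metric_sym) (auto intro!: tangent_sum_mem tangent_scale_mem assms)
  also have "\<dots> = (\<Sum>i\<in>I. c i * g p v (w i))" by (rule metric_sum_right[OF assms])
  also have "\<dots> = (\<Sum>i\<in>I. c i * g p (w i) v)" by (rule sum.cong) (use assms metric_sym in auto)
  finally show ?thesis .
qed

lemma metric_nondegenerate:
  assumes "p \<in> points M" "v \<in> tangent_space M p" "w \<in> tangent_space M p"
    and "\<And>u. u \<in> tangent_space M p \<Longrightarrow> g p v u = g p w u"
  shows "v = w"
proof (rule ccontr)
  assume "v \<noteq> w"
  have d: "v - w \<in> tangent_space M p" using assms tangent_diff_mem by blast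
  have "g p (v - w) (v - w) > 0" using metric_pos[OF assms(1) d] \<open>v \<noteq> w\<close> by simp
  moreover have "g p (v - w) (v - w) = 0" using metric_diff_left[OF assms(1-3) d] assms(4)[OF d] by simp
  ultimately show False by simp
qed

text \<open>Gram--Schmidt: one frame field at a time is split off, so that no matrix has to be inverted.\<close>

lemma smooth_vf_if_metric_smooth:
  assumes "finite I" "openin (topo M) W"
    and "\<And>i. i \<in> I \<Longrightarrow> smooth_vf M W (X i)"
    and "\<And>q c. q \<in> W \<Longrightarrow> (\<Sum>i\<in>I. c i *\<^sub>R X i q) = 0 \<Longrightarrow> \<forall>i\<in>I. c i = (0::real)"
    and "\<And>q. q \<in> W \<Longrightarrow> \<exists>c. Y q = (\<Sum>i\<in>I. c i *\<^sub>R X i q)"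
    and "\<And>Z. smooth_vf M W Z \<Longrightarrow> smooth_fun M W (\<lambda>q. g q (Y q) (Z q))"
  shows "smooth_vf M W Y"
  using assms(1,3-)
proof (induction I arbitrary: X Y rule: finite_induct)
  case empty
  have "0 = Y q" if "q \<in> W" for q using empty.prems(3)[OF that] unfolding sum.empty by metis
  then show ?case by (rule smooth_vf_cong[OF smooth_vf_zero[OF assms(2)]])
next
  case (insert j I)
  note X = insert.prems(1)[of j, simplified] insert.prems(1)[of i for i, simplified]
  have pt: "q \<in> points M" if "q \<in> W" for q using smooth_vf_points[OF X(1) that] .
  have Xt: "X i q \<in> tangent_space M q" if "i = j \<or> i \<in> I" "q \<in> W" for i q
    using smooth_vf_tangent[OF insert.prems(1) that(2)] that(1) by auto
  have Yt: "Y q \<in> tangent_space M q" if q: "q \<in> W" for q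
  proof -
    obtain c where c: "Y q = (\<Sum>i\<in>insert j I. c i *\<^sub>R X i q)" using insert.prems(3)[OF q] by blast
    show ?thesis unfolding c
      by (intro tangent_sum_mem[OF pt[OF q]] tangent_scale_mem[OF pt[OF q]] Xt q) auto
  qed
  define a where "a q = inverse (g q (X j q) (X j q))" for q
  have nz: "X j q \<noteq> 0" if "q \<in> W" for q
  proof
    assume "X j q = 0"
    then have "(\<Sum>i\<in>insert j I. (if i = j then 1 else 0) *\<^sub>R X i q) = 0"
      by (intro sum.neutral) auto
    then show False using insert.prems(2)[OF that] by fastforce
  qed
  have pos: "g q (X j q) (X j q) > 0" if "q \<in> W" for q
    using metric_pos[OF pt[OF that] _ nz[OF that]] Xt[of j q] that by simp
  have a: "smooth_fun M W a" unfolding a_def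
    by (rule smooth_fun_inverse[OF metric_smooth[OF X(1) X(1)]]) (use pos in fastforce)
  \<comment> \<open>\<open>P\<close> removes the component along \<open>X j\<close>, with
    \<open>a\<close> the inverse squared length of \<open>X j\<close>. The induction hypothesis is
    applied to the projected fields.\<close>
  define P where "P Z q = Z q - (a q * g q (Z q) (X j q)) *\<^sub>R X j q" for Z :: "'a \<Rightarrow> 'a tvec" and q
  have Psm: "smooth_vf M W (P Z)" if "smooth_vf M W Z" for Z
    using smooth_vf_add[OF that smooth_vf_scale[OF smooth_fun_minus[OF smooth_fun_mult[OF a metric_smooth[OF that X(1)]]] X(1)]]
    by (simp add: P_def[abs_def])
  \<comment> \<open>Smoothness of \<open>Y\<close> is still the goal; the assumption on its inner
    products already makes this coefficient smooth.\<close>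
  have c_smooth: "smooth_fun M W (\<lambda>q. a q * g q (Y q) (X j q))"
    by (rule smooth_fun_mult[OF a insert.prems(4)[OF X(1)]])
  have "smooth_vf M W (P Y)"
  proof (rule insert.IH[of "\<lambda>i. P (X i)"])
    show "smooth_vf M W (P (X i))" if "i \<in> I" for i using Psm X(2) that by blast
    show "\<forall>i\<in>I. c i = 0" if q: "q \<in> W" and s: "(\<Sum>i\<in>I. c i *\<^sub>R P (X i) q) = 0" for q and c :: "_ \<Rightarrow> real"
    proof -
      \<comment> \<open>Expanding every \<open>P (X i)\<close> collects this coefficient in front of
        \<open>X j\<close>.\<close>
      define d where "d = - (\<Sum>i\<in>I. c i * (a q * g q (X i q) (X j q)))"
      have "(\<Sum>i\<in>insert j I. (if i = j then d else c i) *\<^sub>R X i q) = d *\<^sub>R X j q + (\<Sum>i\<in>I. c i *\<^sub>R X i q)"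
        using insert.hyps by (simp, intro sum.cong) auto
      also have "\<dots> = (\<Sum>i\<in>I. c i *\<^sub>R P (X i) q)"
        by (simp add: P_def d_def algebra_simps sum_subtractf scaleR_sum_left)
      also note s
      finally have z: "\<forall>i\<in>insert j I. (if i = j then d else c i) = 0" by (rule insert.prems(2)[OF q])
      show ?thesis
      proof
        fix i assume "i \<in> I"
        then show "c i = 0" using bspec[OF z, of i] insert.hyps by (simp split: if_splits)
      qed
    qed
    show "\<exists>c. P Y q = (\<Sum>i\<in>I. c i *\<^sub>R P (X i) q)" if q: "q \<in> W" for q
    proof -
      obtain c where c: "Y q = (\<Sum>i\<in>insert j I. c i *\<^sub>R X i q)" using insert.prems(3)[OF q] by blast
      have "g q (Y q) (X j q) = (\<Sum>i\<in>insert j I. c i * g q (X i q) (X j q))"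
        unfolding c by (rule metric_sum_left[OF pt[OF q]]) (use Xt q in auto)
      then have "a q * g q (Y q) (X j q) = c j + (\<Sum>i\<in>I. c i * (a q * g q (X i q) (X j q)))"
        using insert.hyps pos[OF q] by (simp add: a_def distrib_left sum_distrib_left mult.left_commute)
      then have "P Y q = (\<Sum>i\<in>I. c i *\<^sub>R P (X i) q)"
        using insert.hyps c by (simp add: P_def algebra_simps sum_subtractf scaleR_sum_left)
      then show ?thesis by blast
    qed
    show "smooth_fun M W (\<lambda>q. g q (P Y q) (Z q))" if Z: "smooth_vf M W Z" for Z
    proof (rule smooth_fun_cong)
      show "smooth_fun M W (\<lambda>q. g q (Y q) (Z q) + - ((a q * g q (Y q) (X j q)) * g q (X j q) (Z q)))"
        by (intro smooth_fun_add insert.prems(4) Z smooth_fun_minus smooth_fun_mult[OF c_smooth] metric_smooth X(1))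
      show "g q (Y q) (Z q) + - ((a q * g q (Y q) (X j q)) * g q (X j q) (Z q)) = g q (P Y q) (Z q)"
        if "q \<in> W" for q
        using that by (simp add: P_def metric_diff_left metric_scale_left pt Yt Xt tangent_scale_mem smooth_vf_tangent[OF Z])
    qed
  qed
  then have "smooth_vf M W (\<lambda>q. P Y q + (a q * g q (Y q) (X j q)) *\<^sub>R X j q)"
    using smooth_vf_add smooth_vf_scale[OF c_smooth X(1)] by blast
  then show ?case by (simp add: P_def)
qed

text \<open>Turns a field known only through the metric into a smooth one, with the coordinate frame
  as basis. It serves for the gradient of \<open>f\<close> and for \<xi> regarded as a field on the
  submanifold.\<close>

lemma smooth_vf_if_metric_smooth_chart:
  assumes U: "(U, \<kappa>) \<in> atlas M" and W: "openin (topo M) W" "W \<subseteq> U"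
    and Y: "\<And>q. q \<in> W \<Longrightarrow> Y q \<in> tangent_space M q"
    and sm: "\<And>Z. smooth_vf M W Z \<Longrightarrow> smooth_fun M W (\<lambda>q. g q (Y q) (Z q))"
  shows "smooth_vf M W Y"
proof (rule smooth_vf_if_metric_smooth[of Basis W "\<lambda>b q. chart_vec M U \<kappa> q b"])
  show "smooth_vf M W (\<lambda>q. chart_vec M U \<kappa> q b)" for b
    using smooth_vf_subset[OF smooth_vf_chart_vec[OF U] W] .
  show "\<exists>c. Y q = (\<Sum>b\<in>Basis. c b *\<^sub>R chart_vec M U \<kappa> q b)" if "q \<in> W" for q
    by (intro exI[of _ "\<lambda>b. Y q (\<lambda>r. \<kappa> r \<bullet> b)"] tangent_expand[OF U _ Y[OF that]]) (use that W in auto)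
  show "\<forall>b\<in>Basis. c b = 0" if q: "q \<in> W" and s: "(\<Sum>b\<in>Basis. c b *\<^sub>R chart_vec M U \<kappa> q b) = 0" for q and c :: "'b \<Rightarrow> real"
  proof
    fix b :: 'b assume b: "b \<in> Basis"
    have qU: "q \<in> U" using q W by auto
    \<comment> \<open>Evaluating the linear relation at the coordinate function of \<open>b\<close>
      isolates the coefficient \<open>c b\<close>.\<close>
    have "(\<Sum>b'\<in>Basis. c b' *\<^sub>R chart_vec M U \<kappa> q b') (\<lambda>q. \<kappa> q \<bullet> b) = (\<Sum>b'\<in>Basis. c b' * (b' \<bullet> b))"
      by (simp add: sum_fun_apply chart_vec_coord[OF U qU])
    also have "\<dots> = c b" using b by (simp add: inner_Basis if_distrib cong: if_cong)
    finally show "c b = 0" using s by simp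
  qed
qed (use W sm in auto)

end

section \<open>Levi-Civita connections and conformal change\<close>

locale levi_civita_mfd = riemannian_mfd +
  fixes nabla :: "'a connection"
  assumes levi_civita: "levi_civita M g nabla"
begin

lemma connection: "affine_connection M nabla"
  by (rule levi_civita[unfolded levi_civita_def, THEN conjunct1])

lemma torsion_free:
  "smooth_vf M W X \<Longrightarrow> smooth_vf M W Y \<Longrightarrow> p \<in> W \<Longrightarrow> nabla p (X p) Y - nabla p (Y p) X = lie_bracket M X Y p"
  by (rule levi_civita[unfolded levi_civita_def, THEN conjunct2, THEN conjunct1, rule_format])

lemma metric_compatible:
  "smooth_vf M W Y \<Longrightarrow> smooth_vf M W Z \<Longrightarrow> p \<in> W \<Longrightarrow> v \<in> tangent_space M p \<Longrightarrow>
    v (\<lambda>q. g q (Y q) (Z q)) = g p (nabla p v Y) (Z p) + g p (Y p) (nabla p v Z)"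
  by (rule levi_civita[unfolded levi_civita_def, THEN conjunct2, THEN conjunct2, rule_format])

lemma lie_bracket_tangent:
  assumes "smooth_vf M W X" "smooth_vf M W Y" "p \<in> W"
  shows "lie_bracket M X Y p \<in> tangent_space M p"
  unfolding torsion_free[OF assms, symmetric]
  by (intro tangent_diff_mem nabla_tangent[OF connection _ assms(3)] assms smooth_vf_tangent[OF _ assms(3)]
      smooth_vf_points[OF assms(1)])

lemma lie_bracket_apply:
  "smooth_near M p f \<Longrightarrow> lie_bracket M X Y p f = X p (\<lambda>q. Y q f) - Y p (\<lambda>q. X q f)"
  by (simp add: lie_bracket_def)

text \<open>The bracket of two coordinate fields is a tangent vector by torsion-freeness and kills the coordinates,
  hence vanishes; no symmetry of second derivatives is needed.\<close>

lemma nabla_coordinate_sym: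
  assumes U: "(U, \<kappa>) \<in> atlas M" and p: "p \<in> U"
  shows "nabla p (chart_vec M U \<kappa> p a) (\<lambda>q. chart_vec M U \<kappa> q b)
    = nabla p (chart_vec M U \<kappa> p b) (\<lambda>q. chart_vec M U \<kappa> q a)"
proof -
  let ?E = "\<lambda>b q. chart_vec M U \<kappa> q b"
  have E: "smooth_vf M U (?E b)" for b using smooth_vf_chart_vec[OF U] .
  have pM: "p \<in> points M" using chart_subset[OF U] p by blast
  have c: "?E a p (\<lambda>q. ?E b q (\<lambda>r. \<kappa> r \<bullet> d)) = 0" for a b d
  proof -
    have "?E a p (\<lambda>q. ?E b q (\<lambda>r. \<kappa> r \<bullet> d)) = ?E a p (\<lambda>q. b \<bullet> d)"
      by (rule tangent_cong[OF chart_vec_tangent[OF U p] chart_openin[OF U] p]) (rule chart_vec_coord[OF U])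
    then show ?thesis using tangent_const[OF chart_vec_tangent[OF U p] pM] by simp
  qed
  have "lie_bracket M (?E a) (?E b) p = (\<Sum>d\<in>Basis. lie_bracket M (?E a) (?E b) p (\<lambda>r. \<kappa> r \<bullet> d) *\<^sub>R ?E d p)"
    by (rule tangent_expand[OF U p lie_bracket_tangent[OF E E p]])
  also have "\<dots> = 0"
    using c lie_bracket_apply[OF smooth_nearI[OF smooth_fun_coord[OF U] p]] by simp
  finally show ?thesis using torsion_free[OF E E p, of a b] by simp
qed

end

text \<open>The difference of the two sides is symmetric in \<open>X\<close> and \<open>Y\<close> by
  torsion-freeness, and skew in \<open>Y\<close> and \<open>Z\<close> because the correction
  accounts for the derivative of the factor exp(f). With \<open>symmetric_skew_zero\<close> this
  takes the place of the Koszul formula.\<close>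

lemma (in levi_civita_mfd) conformal_connection:
  assumes f: "smooth_fun M (points M) f"
    and g': "levi_civita_mfd M m (\<lambda>p v w. exp (f p) * g p v w) nabla'"
    and XYZ: "smooth_vf M W X" "smooth_vf M W Y" "smooth_vf M W Z" and p: "p \<in> W"
  shows "g p (nabla' p (X p) Y) (Z p) = g p (nabla p (X p) Y) (Z p)
    + (X p f * g p (Y p) (Z p) + Y p f * g p (X p) (Z p) - Z p f * g p (X p) (Y p)) / 2"
proof -
  interpret C: levi_civita_mfd M m "\<lambda>p v w. exp (f p) * g p v w" nabla' by (rule g')
  let ?B = "\<lambda>X Y Z. g p (nabla' p (X p) Y) (Z p) - (g p (nabla p (X p) Y) (Z p)
    + (X p f * g p (Y p) (Z p) + Y p f * g p (X p) (Z p) - Z p f * g p (X p) (Y p)) / 2)"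
  have pM: "p \<in> points M" using smooth_vf_points[OF XYZ(1) p] .
  have fp: "smooth_near M p f" using smooth_nearI[OF f pM] .
  have "?B X Y Z = 0"
  proof (rule symmetric_skew_zero[of "{X. smooth_vf M W X}" ?B])
    fix X Y Z assume "X \<in> {X. smooth_vf M W X}" "Y \<in> {X. smooth_vf M W X}" "Z \<in> {X. smooth_vf M W X}"
    then have XYZ: "smooth_vf M W X" "smooth_vf M W Y" "smooth_vf M W Z" by auto
    note t = XYZ[THEN smooth_vf_tangent, OF p]
    note n = nabla_tangent[OF connection _ p] and n' = nabla_tangent[OF C.connection _ p]
    note s = metric_sym[OF pM]
    have "g p (nabla' p (X p) Y - nabla' p (Y p) X) (Z p) = g p (nabla p (X p) Y - nabla p (Y p) X) (Z p)"
      using torsion_free[OF XYZ(1,2) p] C.torsion_free[OF XYZ(1,2) p] by simp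
    then have "g p (nabla' p (X p) Y) (Z p) - g p (nabla' p (Y p) X) (Z p)
        = g p (nabla p (X p) Y) (Z p) - g p (nabla p (Y p) X) (Z p)"
      using metric_diff_left[OF pM n'[OF XYZ(2) t(1)] n'[OF XYZ(1) t(2)] t(3)]
        metric_diff_left[OF pM n[OF XYZ(2) t(1)] n[OF XYZ(1) t(2)] t(3)] by simp
    then show "?B X Y Z = ?B Y X Z" using s[OF t(1,2)] by (simp add: algebra_simps)
    have gs: "smooth_near M p (\<lambda>q. g q (Y q) (Z q))"
      using smooth_nearI[OF metric_smooth[OF XYZ(2,3)] p] .
    \<comment> \<open>After cancelling exp(f), the two compatibility identities differ by
      \<open>X p f * g p (Y p) (Z p)\<close>, which is the sum of the corrections for (X, Y, Z) and
      (X, Z, Y).\<close>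
    have "exp (f p) * (g p (nabla' p (X p) Y) (Z p) + g p (Y p) (nabla' p (X p) Z))
        = X p (\<lambda>q. exp (f q) * g q (Y q) (Z q))"
      using C.metric_compatible[OF XYZ(2,3) p t(1)] by (simp add: distrib_left)
    also have "\<dots> = exp (f p) * X p f * g p (Y p) (Z p) + exp (f p) * X p (\<lambda>q. g q (Y q) (Z q))"
      using tangent_mult[OF t(1) smooth_near_exp[OF fp] gs] tangent_exp[OF t(1) fp] by simp
    also have "\<dots> = exp (f p) * (X p f * g p (Y p) (Z p) + (g p (nabla p (X p) Y) (Z p) + g p (Y p) (nabla p (X p) Z)))"
      using metric_compatible[OF XYZ(2,3) p t(1)] by (simp add: distrib_left)
    finally have "g p (nabla' p (X p) Y) (Z p) + g p (nabla' p (X p) Z) (Y p)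
        = X p f * g p (Y p) (Z p) + (g p (nabla p (X p) Y) (Z p) + g p (nabla p (X p) Z) (Y p))"
      using s[OF t(2) n'[OF XYZ(3) t(1)]] s[OF t(2) n[OF XYZ(3) t(1)]] by simp
    then show "?B X Y Z = - ?B X Z Y" using s[OF t(2,3)] by (simp add: field_simps)
  qed (use XYZ in auto)
  then show ?thesis by simp
qed

section \<open>The derivative of \<xi> on Kenmotsu and conformal Kenmotsu manifolds\<close>

lemma kenmotsu_levi_civita_mfd:
  assumes "kenmotsu n M \<phi> \<xi> \<eta> g nabla"
  shows "levi_civita_mfd M (2 * n + 1) g nabla"
  by unfold_locales (use assms in \<open>auto simp: kenmotsu_def almost_contact_metric_def\<close>)

text \<open>The identity for \<open>(\<nabla>\<^sub>v\<phi>)\<xi>\<close> gives \<open>\<phi>(\<nabla>\<^sub>v\<xi>) = \<phi> v\<close>, and \<open>\<nabla>\<^sub>v\<xi>\<close> is orthogonal to the unit field \<open>\<xi>\<close>.\<close>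

lemma kenmotsu_nabla_xi:
  assumes K: "kenmotsu n M \<phi> \<xi> \<eta> g nabla" and p: "p \<in> points M" and v: "v \<in> tangent_space M p"
  shows "nabla p v \<xi> = v - \<eta> p v *\<^sub>R \<xi> p"
proof -
  interpret levi_civita_mfd M "2 * n + 1" g nabla by (rule kenmotsu_levi_civita_mfd[OF K])
  have acm: "almost_contact_metric n M \<phi> \<xi> \<eta> g" using K by (simp add: kenmotsu_def)
  have \<xi>: "smooth_vf M (points M) \<xi>" using acm by (simp add: almost_contact_metric_def)
  have pt: "\<eta> q (\<xi> q) = 1" "\<phi> q (\<xi> q) = 0" "w \<in> tangent_space M q \<Longrightarrow> \<phi> q (\<phi> q w) = - w + \<eta> q w *\<^sub>R \<xi> q"
    "w \<in> tangent_space M q \<Longrightarrow> \<eta> q w = g q w (\<xi> q)" if "q \<in> points M" for q w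
    using acm that unfolding almost_contact_metric_def by blast+
  have D: "nabla p v \<xi> \<in> tangent_space M p" using nabla_tangent[OF connection \<xi> p v] .
  have \<xi>p: "\<xi> p \<in> tangent_space M p" using smooth_vf_tangent[OF \<xi> p] .
  have "cov_deriv_tensor11 nabla \<phi> p v \<xi> = - (g p v (\<phi> p (\<xi> p)) *\<^sub>R \<xi> p) - \<eta> p (\<xi> p) *\<^sub>R \<phi> p v"
    using K \<xi> p v unfolding kenmotsu_def by blast
  then have "nabla p v (\<lambda>q. \<phi> q (\<xi> q)) - \<phi> p (nabla p v \<xi>) = - \<phi> p v"
    using pt(1,2)[OF p] metric_zero[OF p v] by (simp add: cov_deriv_tensor11_def)
  moreover have "nabla p v (\<lambda>q. \<phi> q (\<xi> q)) = 0"
  proof -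
    \<comment> \<open>The structure equations make \<phi>\<xi> vanish on the points of
      \<open>M\<close> only, so locality of the connection is what replaces it by the zero
      field.\<close>
    have "nabla p v (\<lambda>q. 0) = nabla p v (\<lambda>q. \<phi> q (\<xi> q))"
      by (rule nabla_cong[OF connection smooth_vf_zero[OF smooth_vf_openin[OF \<xi>]] _ p v]) (simp add: pt(2))
    then show ?thesis using nabla_zero[OF connection p v] by simp
  qed
  ultimately have "\<phi> p (nabla p v \<xi>) = \<phi> p v" by simp
  then have eq: "- nabla p v \<xi> + \<eta> p (nabla p v \<xi>) *\<^sub>R \<xi> p = - v + \<eta> p v *\<^sub>R \<xi> p"
    using pt(3)[OF p D] pt(3)[OF p v] by simp
  have "v (\<lambda>q. g q (\<xi> q) (\<xi> q)) = v (\<lambda>q. 1)"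
    by (rule tangent_cong[OF v smooth_vf_openin[OF \<xi>] p]) (use pt smooth_vf_tangent[OF \<xi>] in metis)
  then have "2 * g p (nabla p v \<xi>) (\<xi> p) = 0"
    using metric_compatible[OF \<xi> \<xi> p v] metric_sym[OF p D \<xi>p] tangent_const[OF v p] by simp
  then have "\<eta> p (nabla p v \<xi>) = 0" using pt(4)[OF p D] by simp
  with eq show ?thesis by (simp add: algebra_simps)
qed

text \<open>Writing \<xi> as exp(f/2) times the Kenmotsu field, the Leibniz rule for
  \<open>nabla'\<close> produces the extra term (v f / 2) \<xi>. The conformal correction contains
  the same term, so it cancels.\<close>

lemma (in levi_civita_mfd) conformal_kenmotsu_nabla_xi:
  assumes K: "kenmotsu n M \<phi> (\<lambda>p. exp (- f p / 2) *\<^sub>R \<xi> p) (\<lambda>p v. exp (f p / 2) * \<eta> p v)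
      (\<lambda>p v w. exp (f p) * g p v w) nabla'"
    and acm: "almost_contact_metric n M \<phi> \<xi> \<eta> g" and m: "m = 2 * n + 1"
    and f: "smooth_fun M (points M) f"
    and p: "p \<in> points M" and v: "v \<in> tangent_space M p" and w: "w \<in> tangent_space M p"
  shows "g p (nabla p v \<xi>) w = exp (f p / 2) * (g p v w - \<eta> p v * \<eta> p w)
    - \<xi> p f * g p v w / 2 + w f * \<eta> p v / 2"
proof -
  let ?\<xi>' = "\<lambda>p. exp (- f p / 2) *\<^sub>R \<xi> p"
  have C: "levi_civita_mfd M m (\<lambda>p v w. exp (f p) * g p v w) nabla'"
    unfolding m by (rule kenmotsu_levi_civita_mfd[OF K])
  interpret C: levi_civita_mfd M m "\<lambda>p v w. exp (f p) * g p v w" nabla' by (rule C)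
  have \<xi>: "smooth_vf M (points M) \<xi>" using acm by (simp add: almost_contact_metric_def)
  have \<xi>': "smooth_vf M (points M) ?\<xi>'" using K by (simp add: kenmotsu_def almost_contact_metric_def)
  have \<eta>: "\<eta> p w = g p w (\<xi> p)" if "w \<in> tangent_space M p" for w
    using acm p that unfolding almost_contact_metric_def by blast
  have \<xi>p: "\<xi> p \<in> tangent_space M p" using smooth_vf_tangent[OF \<xi> p] .
  have o: "openin (topo M) (points M)" by (simp add: points_def)
  have h2: "smooth_fun M (points M) (\<lambda>q. f q * (1 / 2))"
    by (rule smooth_fun_mult[OF f smooth_fun_const[OF o]])
  have vh: "v (\<lambda>q. exp (f q * (1 / 2))) = exp (f p / 2) * (v f / 2)"
    using tangent_exp[OF v smooth_nearI[OF h2 p]] tangent_mult[OF v smooth_nearI[OF f p] smooth_near_const[OF p], of "1/2"]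
      tangent_const[OF v p, of "1 / 2"] by simp
  \<comment> \<open>True at every element of the type, also outside \<open>M\<close>, so it may be
    substituted under \<open>nabla'\<close> as an equality of functions.\<close>
  have \<xi>_eq: "(\<lambda>q. exp (f q * (1 / 2)) *\<^sub>R ?\<xi>' q) = \<xi>"
    by (rule ext) (simp only: scaleR_scaleR mult_exp_exp, simp)
  have L: "nabla' p v (\<lambda>q. exp (f q * (1 / 2)) *\<^sub>R ?\<xi>' q)
      = v (\<lambda>q. exp (f q * (1 / 2))) *\<^sub>R ?\<xi>' p + exp (f p * (1 / 2)) *\<^sub>R nabla' p v ?\<xi>'"
    by (rule nabla_leibniz[OF C.connection smooth_fun_exp[OF h2] \<xi>' p v])
  have "nabla' p v ?\<xi>' = v - \<eta> p v *\<^sub>R \<xi> p"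
    using kenmotsu_nabla_xi[OF K p v] by (simp add: mult_exp_exp mult.assoc[symmetric])
  with L have "nabla' p v \<xi> = (exp (f p / 2) * (v f / 2) * exp (- f p / 2)) *\<^sub>R \<xi> p
      + exp (f p / 2) *\<^sub>R (v - \<eta> p v *\<^sub>R \<xi> p)"
    unfolding vh \<xi>_eq by (simp only: scaleR_scaleR mult_1_right times_divide_eq_right)
  moreover have "exp (f p / 2) * (v f / 2) * exp (- f p / 2) = v f / 2"
    by (simp add: exp_minus field_simps)
  ultimately have d: "nabla' p v \<xi> = (v f / 2) *\<^sub>R \<xi> p + exp (f p / 2) *\<^sub>R (v - \<eta> p v *\<^sub>R \<xi> p)"
    by (simp only:)
  obtain U \<kappa> where U: "(U, \<kappa>) \<in> atlas M" "p \<in> U" using chart_at[OF p] .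
  \<comment> \<open>\<open>conformal_connection\<close> speaks of fields, so both vectors are
    extended over the chart domain.\<close>
  obtain X where X: "smooth_vf M U X" "X p = v" using tangent_extend[OF U v] .
  obtain Z where Z: "smooth_vf M U Z" "Z p = w" using tangent_extend[OF U w] .
  have "g p (nabla' p v \<xi>) w = g p (nabla p v \<xi>) w + (v f * g p (\<xi> p) w + \<xi> p f * g p v w - w f * g p v (\<xi> p)) / 2"
    using conformal_connection[OF f C X(1) smooth_vf_subset[OF \<xi> chart_openin[OF U(1)] chart_subset[OF U(1)]] Z(1) U(2)]
    unfolding X(2) Z(2) .
  moreover have "g p (nabla' p v \<xi>) w = v f / 2 * g p (\<xi> p) w + exp (f p / 2) * (g p v w - \<eta> p v * g p (\<xi> p) w)"
    unfolding d using p v w \<xi>p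
    by (simp add: metric_add_left metric_scale_left metric_diff_left tangent_scale_mem tangent_diff_mem)
  ultimately show ?thesis using \<eta>[OF v] \<eta>[OF w] metric_sym[OF p \<xi>p w] by (simp add: field_simps)
qed

section \<open>Submanifolds and the Gauss formula\<close>

lemma push_add: "push M p (v + w) = push M p v + push M p w"
  by (rule ext) (simp add: differential_def)

lemma push_scaleR: "push M p (a *\<^sub>R v) = a *\<^sub>R push M p v"
  by (rule ext) (simp add: differential_def)

lemma push_zero: "push M p 0 = 0"
  by (rule ext) (simp add: differential_def)

lemma push_apply: "smooth_near M p h \<Longrightarrow> push M p v h = v h"
  by (simp add: differential_def)

locale embedded_mfd = smooth_mfd M m + S: smooth_mfd S mS
  for M :: "('a, 'e::euclidean_space) mfd" and m and S :: "('a, 'h::euclidean_space) mfd" and mS +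
  assumes embedded: "embedded_submanifold mS S M"
begin

lemma sub_points: "p \<in> points S \<Longrightarrow> p \<in> points M"
  using embedded unfolding embedded_submanifold_def by blast

lemma sub_topo: "topo S = subtopology (topo M) (points S)"
  using embedded unfolding embedded_submanifold_def by blast

lemma sub_openin: "openin (topo M) W \<Longrightarrow> openin (topo S) (W \<inter> points S)"
  by (subst sub_topo) (auto simp: openin_subtopology)

lemma sub_openin_chart: "(V, \<psi>) \<in> atlas M \<Longrightarrow> openin (topo S) (V \<inter> points S)"
  using sub_openin chart_openin by blast

lemma push_inj: "p \<in> points S \<Longrightarrow> inj_on (push M p) (tangent_space S p)"
  using embedded unfolding embedded_submanifold_def immersion_def by blast

lemma inclusion_smooth:
  assumes "(U, \<kappa>) \<in> atlas S" "(V, \<psi>) \<in> atlas M"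
  shows "smooth_on (\<kappa> ` (U \<inter> V)) (\<psi> \<circ> inv_into U \<kappa>)"
proof -
  have "smooth_map S M id" using embedded unfolding embedded_submanifold_def immersion_def by blast
  then have "smooth_on (\<kappa> ` (U \<inter> id -` V)) (\<psi> \<circ> id \<circ> inv_into U \<kappa>)"
    using assms unfolding smooth_map_def by fast
  then show ?thesis by simp
qed

lemma open_sub_chart_image:
  assumes "(U, \<kappa>) \<in> atlas S" "openin (topo M) W"
  shows "open (\<kappa> ` (U \<inter> W))"
proof -
  have "U \<inter> W = U \<inter> (W \<inter> points S)" using S.chart_subset[OF assms(1)] by blast
  then show ?thesis
    using S.open_chart_image[OF assms(1) S.openin_Int_chart[OF assms(1) sub_openin[OF assms(2)]]] by simp
qed

lemma smooth_fun_restrict: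
  assumes h: "smooth_fun M W h"
  shows "smooth_fun S (W \<inter> points S) h"
proof (rule S.smooth_funI)
  have W: "openin (topo M) W" using smooth_fun_openin[OF h] .
  show "openin (topo S) (W \<inter> points S)" using sub_openin[OF W] .
  fix p assume p: "p \<in> W \<inter> points S"
  obtain U \<kappa> where U: "(U, \<kappa>) \<in> atlas S" "p \<in> U" using S.chart_at[of p] p by blast
  obtain V \<psi> where V: "(V, \<psi>) \<in> atlas M" "p \<in> V" using chart_at[OF sub_points[of p]] p by blast
  have VW: "openin (topo M) (V \<inter> W)" using openin_Int_chart[OF V(1) W] .
  let ?W' = "U \<inter> (V \<inter> W)"
  have eq: "?W' = U \<inter> (V \<inter> W \<inter> points S)" using S.chart_subset[OF U(1)] by blast
  have o: "open (\<kappa> ` ?W')" using open_sub_chart_image[OF U(1) VW] .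
  have o': "open (\<psi> ` (V \<inter> W))" using open_chart_image[OF V(1) VW] by blast
  have h': "smooth_on (\<psi> ` (V \<inter> W)) (h \<circ> inv_into V \<psi>)" by (rule smooth_fun_chartD[OF h V(1)]) simp
  have i: "smooth_on (\<kappa> ` ?W') (\<psi> \<circ> inv_into U \<kappa>)"
    by (rule smooth_on_subset[OF inclusion_smooth[OF U(1) V(1)]]) auto
  have "smooth_on (\<kappa> ` ?W') (\<lambda>y. (h \<circ> inv_into V \<psi>) ((\<psi> \<circ> inv_into U \<kappa>) y))"
    by (rule smooth_on_compose[OF o o' _ h' i]) (auto simp: S.chart_inv[OF U(1)])
  then have "smooth_on (\<kappa> ` ?W') (h \<circ> inv_into U \<kappa>)"
    by (rule smooth_on_cong[OF o, rotated]) (auto simp: S.chart_inv[OF U(1)] chart_inv[OF V(1)])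
  moreover have "openin (topo S) ?W'" unfolding eq
    using S.openin_Int_chart[OF U(1) sub_openin[OF VW]] .
  ultimately show "\<exists>U \<kappa> W'. (U, \<kappa>) \<in> atlas S \<and> openin (topo S) W' \<and> p \<in> W' \<and>
      W' \<subseteq> U \<inter> (W \<inter> points S) \<and> smooth_on (\<kappa> ` W') (h \<circ> inv_into U \<kappa>)"
    using U V p S.chart_subset[OF U(1)] by (intro exI[of _ U] exI[of _ \<kappa>] exI[of _ ?W']) auto
qed

lemma smooth_near_restrict:
  assumes "smooth_near M p h" "p \<in> points S"
  shows "smooth_near S p h"
proof -
  obtain W where "p \<in> W" "smooth_fun M W h" using assms(1) unfolding smooth_near_def by blast
  then show ?thesis using S.smooth_nearI[OF smooth_fun_restrict] assms(2) by blast
qed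

text \<open>In charts \<open>push\<close> is the Jacobian of the inclusion, so the image is again a
  chart vector.\<close>

lemma push_tangent:
  assumes v: "v \<in> tangent_space S p" and p: "p \<in> points S"
  shows "push M p v \<in> tangent_space M p"
proof -
  obtain U \<kappa> u where U: "(U, \<kappa>) \<in> atlas S" "p \<in> U" "v = chart_vec S U \<kappa> p u"
    using S.tangent_space_obtain_chart[OF v] .
  obtain V \<psi> where V: "(V, \<psi>) \<in> atlas M" "p \<in> V" using chart_at[OF sub_points[OF p]] .
  let ?\<tau> = "\<psi> \<circ> inv_into U \<kappa>"
  let ?D = "frechet_derivative ?\<tau> (at (\<kappa> p))"
  have \<tau>: "(?\<tau> has_derivative ?D) (at (\<kappa> p))"
    by (rule smooth_on_has_derivative[OF inclusion_smooth[OF U(1) V(1)]]) (use U V in auto)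
  have "push M p v h = chart_vec M V \<psi> p (?D u) h" for h
  proof (cases "smooth_near M p h")
    case True
    have "(h \<circ> inv_into V \<psi> has_derivative (\<lambda>u. chart_vec M V \<psi> p u h)) (at (?\<tau> (\<kappa> p)))"
      using chart_vec_has_derivative[OF V True] by (simp add: S.chart_inv[OF U(1,2)])
    from diff_chain_at[OF \<tau> this]
    have "((h \<circ> inv_into V \<psi>) \<circ> ?\<tau> has_derivative (\<lambda>u. chart_vec M V \<psi> p (?D u) h)) (at (\<kappa> p))"
      by (simp add: o_def)
    then have "(h \<circ> inv_into U \<kappa> has_derivative (\<lambda>u. chart_vec M V \<psi> p (?D u) h)) (at (\<kappa> p))"
      by (rule has_derivative_transform_within_open[of _ _ _ _ "\<kappa> ` (U \<inter> V)"])
         (use U V open_sub_chart_image[OF U(1) chart_openin[OF V(1)]]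
          in \<open>auto simp: S.chart_inv[OF U(1)] chart_inv[OF V(1)]\<close>)
    then have "v h = chart_vec M V \<psi> p (?D u) h" unfolding U(3)
      by (rule S.chart_vec_eq[OF U(1,2) smooth_near_restrict[OF True p]])
    then show ?thesis by (simp add: push_apply[OF True])
  qed (simp add: chart_vec_not_smooth differential_def)
  then have "push M p v = chart_vec M V \<psi> p (?D u)" by (rule ext)
  then show ?thesis using chart_vec_tangent[OF V] by simp
qed

lemma push_coord: "(V, \<psi>) \<in> atlas M \<Longrightarrow> p \<in> V \<Longrightarrow> push M p v (\<lambda>r. \<psi> r \<bullet> b) = v (\<lambda>r. \<psi> r \<bullet> b)"
  using push_apply[OF smooth_nearI[OF smooth_fun_coord]] .

text \<open>Smoothness of a field along \<open>S\<close> with values tangent to \<open>M\<close>,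
  read through its components in a chart of \<open>M\<close>. Pushed fields of \<open>S\<close> and
  restricted fields of \<open>M\<close> both qualify and can thus be paired by
  \<open>g\<close>.\<close>

definition smooth_along_in_chart :: "'a set \<Rightarrow> ('a \<Rightarrow> 'e) \<Rightarrow> 'a set \<Rightarrow> ('a \<Rightarrow> 'a tvec) \<Rightarrow> bool" where
  "smooth_along_in_chart V \<psi> W Y \<longleftrightarrow> (V, \<psi>) \<in> atlas M \<and> W \<subseteq> V \<and> openin (topo S) W \<and>
     (\<forall>q\<in>W. Y q \<in> tangent_space M q) \<and> (\<forall>b. smooth_fun S W (\<lambda>q. Y q (\<lambda>r. \<psi> r \<bullet> b)))"

lemma smooth_along_in_chart_push:
  assumes V: "(V, \<psi>) \<in> atlas M" and X: "smooth_vf S W X" and W: "W \<subseteq> V"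
  shows "smooth_along_in_chart V \<psi> W (\<lambda>q. push M q (X q))"
proof -
  have WS: "W \<subseteq> V \<inter> points S" using W S.smooth_vf_points[OF X] by blast
  have "smooth_fun S W (\<lambda>q. push M q (X q) (\<lambda>r. \<psi> r \<bullet> b))" for b
  proof (rule S.smooth_fun_cong)
    show "smooth_fun S W (\<lambda>q. X q (\<lambda>r. \<psi> r \<bullet> b))"
      using S.smooth_vf_fun[OF X S.smooth_fun_subset[OF smooth_fun_restrict[OF smooth_fun_coord[OF V]]
          S.smooth_vf_openin[OF X] WS]] by simp
    show "X q (\<lambda>r. \<psi> r \<bullet> b) = push M q (X q) (\<lambda>r. \<psi> r \<bullet> b)" if "q \<in> W" for q
      using push_coord[OF V] that W by auto
  qed
  then show ?thesis
    using assms S.smooth_vf_openin[OF X] push_tangent[OF S.smooth_vf_tangent[OF X] S.smooth_vf_points[OF X]]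
    unfolding smooth_along_in_chart_def by blast
qed

lemma smooth_along_in_chart_restrict:
  assumes V: "(V, \<psi>) \<in> atlas M" and X: "smooth_vf M V' X" and W: "openin (topo S) W" "W \<subseteq> V \<inter> V'"
  shows "smooth_along_in_chart V \<psi> W X"
proof -
  have WS: "W \<subseteq> (V \<inter> V') \<inter> points S" using W openin_subset unfolding points_def by blast
  have X': "smooth_vf M (V \<inter> V') X"
    by (rule smooth_vf_subset[OF X openin_Int_chart[OF V smooth_vf_openin[OF X]]]) simp
  have "smooth_fun S W (\<lambda>q. X q (\<lambda>r. \<psi> r \<bullet> b))" for b
    by (rule S.smooth_fun_subset[OF smooth_fun_restrict[OF smooth_vf_coord[OF V X']] W(1) WS]) simp
  then show ?thesis
    using V W smooth_vf_tangent[OF X] unfolding smooth_along_in_chart_def by blast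
qed

end

section \<open>The induced metric\<close>

locale riemannian_submfd = embedded_mfd M m S mS + riemannian_mfd M m g
  for M :: "('a, 'e::euclidean_space) mfd" and m and S :: "('a, 'h::euclidean_space) mfd" and mS and g
begin

text \<open>The smoothness axiom for \<open>g\<close> concerns fields on open subsets of
  \<open>M\<close>. In this expansion it is needed for the coordinate frame only, with component
  functions on \<open>S\<close> as coefficients.\<close>

lemma metric_along_expand:
  assumes Y: "smooth_along_in_chart V \<psi> W Y" and Z: "smooth_along_in_chart V \<psi> W Z" and q: "q \<in> W"
  shows "g q (Y q) (Z q) = (\<Sum>a\<in>Basis. \<Sum>b\<in>Basis. Y q (\<lambda>r. \<psi> r \<bullet> a) *
      (Z q (\<lambda>r. \<psi> r \<bullet> b) * g q (chart_vec M V \<psi> q a) (chart_vec M V \<psi> q b)))"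
proof -
  have V: "(V, \<psi>) \<in> atlas M" "q \<in> V" using Y q unfolding smooth_along_in_chart_def by auto
  have qM: "q \<in> points M" using chart_subset V by blast
  have t: "Y q \<in> tangent_space M q" "Z q \<in> tangent_space M q"
    using Y Z q unfolding smooth_along_in_chart_def by auto
  have "g q (Y q) (Z q) = g q (\<Sum>a\<in>Basis. Y q (\<lambda>r. \<psi> r \<bullet> a) *\<^sub>R chart_vec M V \<psi> q a)
      (\<Sum>b\<in>Basis. Z q (\<lambda>r. \<psi> r \<bullet> b) *\<^sub>R chart_vec M V \<psi> q b)"
    using tangent_expand[OF V t(1)] tangent_expand[OF V t(2)] by simp
  also have "\<dots> = (\<Sum>a\<in>Basis. Y q (\<lambda>r. \<psi> r \<bullet> a) *
      g q (chart_vec M V \<psi> q a) (\<Sum>b\<in>Basis. Z q (\<lambda>r. \<psi> r \<bullet> b) *\<^sub>R chart_vec M V \<psi> q b))"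
    by (intro metric_sum_left qM chart_vec_tangent[OF V] tangent_sum_mem tangent_scale_mem)
  also have "\<dots> = (\<Sum>a\<in>Basis. Y q (\<lambda>r. \<psi> r \<bullet> a) * (\<Sum>b\<in>Basis. Z q (\<lambda>r. \<psi> r \<bullet> b) *
      g q (chart_vec M V \<psi> q a) (chart_vec M V \<psi> q b)))"
    by (simp add: metric_sum_right[OF qM chart_vec_tangent[OF V] chart_vec_tangent[OF V]])
  finally show ?thesis by (simp add: sum_distrib_left)
qed

lemma smooth_fun_metric_chart:
  assumes "(V, \<psi>) \<in> atlas M" "openin (topo S) W" "W \<subseteq> V"
  shows "smooth_fun S W (\<lambda>q. g q (chart_vec M V \<psi> q a) (chart_vec M V \<psi> q b))"
proof (rule S.smooth_fun_subset[OF smooth_fun_restrict[OF metric_smooth[OF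
        smooth_vf_chart_vec[OF assms(1)] smooth_vf_chart_vec[OF assms(1)]]]])
  show "W \<subseteq> V \<inter> points S" using assms openin_subset unfolding points_def by blast
qed (use assms in auto)

lemma smooth_fun_metric_along:
  assumes Y: "smooth_along_in_chart V \<psi> W Y" and Z: "smooth_along_in_chart V \<psi> W Z"
  shows "smooth_fun S W (\<lambda>q. g q (Y q) (Z q))"
proof (rule S.smooth_fun_cong[OF _ metric_along_expand[OF Y Z, symmetric]])
  have "openin (topo S) W" "(V, \<psi>) \<in> atlas M" "W \<subseteq> V"
    "\<And>b. smooth_fun S W (\<lambda>q. Y q (\<lambda>r. \<psi> r \<bullet> b))" "\<And>b. smooth_fun S W (\<lambda>q. Z q (\<lambda>r. \<psi> r \<bullet> b))"
    using Y Z unfolding smooth_along_in_chart_def by auto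
  then show "smooth_fun S W (\<lambda>q. \<Sum>a\<in>Basis. \<Sum>b\<in>Basis. Y q (\<lambda>r. \<psi> r \<bullet> a) *
      (Z q (\<lambda>r. \<psi> r \<bullet> b) * g q (chart_vec M V \<psi> q a) (chart_vec M V \<psi> q b)))"
    by (intro S.smooth_fun_sum S.smooth_fun_mult smooth_fun_metric_chart)
qed

lemma riemannian_induced: "riemannian_metric S (induced_metric M g)"
  unfolding riemannian_metric_def
proof (intro conjI ballI allI impI)
  fix p v assume p: "p \<in> points S" and v: "v \<in> tangent_space S p"
  note pM = sub_points[OF p] and pv = push_tangent[OF _ p]
  show "linear_map_on (tangent_space S p) (induced_metric M g p v)"
    unfolding linear_map_on_def induced_metric_def
    by (auto simp: push_add push_scaleR metric_add_right metric_scale_right pM pv v)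
  show "induced_metric M g p v w = induced_metric M g p w v" if "w \<in> tangent_space S p" for w
    unfolding induced_metric_def using metric_sym[OF pM pv[OF v] pv[OF that]] .
  show "induced_metric M g p v v > 0" if "v \<noteq> 0"
  proof -
    \<comment> \<open>Positivity passes to \<open>S\<close> because the inclusion is an
      immersion.\<close>
    have "push M p v \<noteq> push M p 0"
      using inj_onD[OF push_inj[OF p] _ v subspace_0[OF S.subspace_tangent_space[OF p]]] that by blast
    then show ?thesis unfolding induced_metric_def using metric_pos[OF pM pv[OF v]] by (simp add: push_zero)
  qed
next
  fix W X Y assume X: "smooth_vf S W X" and Y: "smooth_vf S W Y"
  show "smooth_fun S W (\<lambda>p. induced_metric M g p (X p) (Y p))"
  proof (rule S.smooth_fun_local)
    fix p assume p: "p \<in> W"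
    obtain V \<psi> where V: "(V, \<psi>) \<in> atlas M" "p \<in> V"
      using chart_at[OF sub_points[OF S.smooth_vf_points[OF X p]]] .
    let ?W' = "W \<inter> (V \<inter> points S)"
    have o: "openin (topo S) ?W'" using sub_openin_chart[OF V(1)] S.smooth_vf_openin[OF X] by blast
    have XY: "smooth_vf S ?W' X" "smooth_vf S ?W' Y" using S.smooth_vf_subset[OF _ o] X Y by auto
    have "smooth_fun S ?W' (\<lambda>p. induced_metric M g p (X p) (Y p))"
      unfolding induced_metric_def
      by (rule smooth_fun_metric_along[OF smooth_along_in_chart_push[OF V(1) XY(1)]
            smooth_along_in_chart_push[OF V(1) XY(2)]]) auto
    then show "\<exists>W'. p \<in> W' \<and> W' \<subseteq> W \<and> smooth_fun S W' (\<lambda>p. induced_metric M g p (X p) (Y p))"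
      using p V(2) S.smooth_vf_points[OF X p] by (intro exI[of _ ?W'] conjI IntI Int_lower1)
  qed
qed

end

section \<open>The pullback connection\<close>

locale levi_civita_submfd = riemannian_submfd M m S mS g + levi_civita_mfd M m g nabla
  for M :: "('a, 'e::euclidean_space) mfd" and m and S :: "('a, 'h::euclidean_space) mfd" and mS and g and nabla
begin

text \<open>This is the pullback connection on fields along \<open>S\<close>, written in the coordinate frame of \<open>M\<close>, so that fields on \<open>S\<close> need not be extended to \<open>M\<close>.\<close>

definition nabla_along :: "'a set \<Rightarrow> ('a \<Rightarrow> 'e) \<Rightarrow> 'a \<Rightarrow> 'a tvec \<Rightarrow> ('a \<Rightarrow> 'a tvec) \<Rightarrow> 'a tvec" where
  "nabla_along V \<psi> p v Y = (\<Sum>b\<in>Basis. v (\<lambda>q. Y q (\<lambda>r. \<psi> r \<bullet> b)) *\<^sub>R chart_vec M V \<psi> p b) +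
     (\<Sum>b\<in>Basis. Y p (\<lambda>r. \<psi> r \<bullet> b) *\<^sub>R nabla p (push M p v) (\<lambda>q. chart_vec M V \<psi> q b))"

lemma nabla_along_tangent:
  assumes V: "(V, \<psi>) \<in> atlas M" "p \<in> V" and p: "p \<in> points S" and v: "v \<in> tangent_space S p"
  shows "nabla_along V \<psi> p v Y \<in> tangent_space M p"
  unfolding nabla_along_def
  by (intro tangent_add_mem tangent_sum_mem tangent_scale_mem sub_points[OF p] chart_vec_tangent[OF V]
      nabla_tangent[OF connection smooth_vf_chart_vec[OF V(1)] V(2) push_tangent[OF v p]])

text \<open>Only values on \<open>S\<close> enter, by locality of \<open>v\<close>. This permits
  exchanging \<xi> with the push-forward of its copy on \<open>S\<close>.\<close>

lemma nabla_along_cong: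
  assumes v: "v \<in> tangent_space S p" and W: "openin (topo S) W" "p \<in> W" and eq: "\<And>q. q \<in> W \<Longrightarrow> Y q = Z q"
  shows "nabla_along V \<psi> p v Y = nabla_along V \<psi> p v Z"
proof -
  have "v (\<lambda>q. Y q (\<lambda>r. \<psi> r \<bullet> b)) = v (\<lambda>q. Z q (\<lambda>r. \<psi> r \<bullet> b))" for b
    by (rule S.tangent_cong[OF v W]) (simp add: eq)
  then show ?thesis using eq[OF W(2)] by (simp add: nabla_along_def)
qed

text \<open>Ties the coordinate formula to the connection of \<open>M\<close>: expand
  \<open>Y\<close> in the coordinate frame and apply the Leibniz rule.\<close>

lemma nabla_along_restrict:
  assumes V: "(V, \<psi>) \<in> atlas M" "p \<in> V" and Y: "smooth_vf M V Y" and p: "p \<in> points S"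
    and v: "v \<in> tangent_space S p"
  shows "nabla_along V \<psi> p v Y = nabla p (push M p v) Y"
proof -
  note pv = push_tangent[OF v p]
  have "nabla p (push M p v) Y = nabla p (push M p v) (\<lambda>q. \<Sum>b\<in>Basis. Y q (\<lambda>r. \<psi> r \<bullet> b) *\<^sub>R chart_vec M V \<psi> q b)"
    by (rule nabla_cong[OF connection Y tangent_expand[OF V(1) _ smooth_vf_tangent[OF Y]] V(2) pv])
  also have "\<dots> = (\<Sum>b\<in>Basis. push M p v (\<lambda>q. Y q (\<lambda>r. \<psi> r \<bullet> b)) *\<^sub>R chart_vec M V \<psi> p b
      + Y p (\<lambda>r. \<psi> r \<bullet> b) *\<^sub>R nabla p (push M p v) (\<lambda>q. chart_vec M V \<psi> q b))"
    by (intro nabla_sum[OF connection V(2) pv chart_openin[OF V(1)]] smooth_vf_coord[OF V(1) Y]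
        smooth_vf_chart_vec[OF V(1)] order_refl)
  also have "\<dots> = nabla_along V \<psi> p v Y"
    unfolding nabla_along_def sum.distrib
    using push_apply[OF smooth_nearI[OF smooth_vf_coord[OF V(1) Y order_refl] V(2)], of v] by simp
  finally show ?thesis by simp
qed

text \<open>Ambient compatibility enters for the coordinate frame only; the components, which are
  functions on \<open>S\<close>, are differentiated by the product rule.\<close>

lemma nabla_along_metric:
  assumes Y: "smooth_along_in_chart V \<psi> W Y" and Z: "smooth_along_in_chart V \<psi> W Z"
    and p: "p \<in> W" and v: "v \<in> tangent_space S p"
  shows "v (\<lambda>q. g q (Y q) (Z q)) = g p (nabla_along V \<psi> p v Y) (Z p) + g p (Y p) (nabla_along V \<psi> p v Z)"
proof -
  let ?E = "\<lambda>a q. chart_vec M V \<psi> q a"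
  let ?G = "\<lambda>a b q. g q (?E a q) (?E b q)"
  let ?y = "\<lambda>a q. Y q (\<lambda>r. \<psi> r \<bullet> a)" and ?z = "\<lambda>a q. Z q (\<lambda>r. \<psi> r \<bullet> a)"
  let ?n = "\<lambda>a. nabla p (push M p v) (?E a)"
  have W: "openin (topo S) W" and V: "(V, \<psi>) \<in> atlas M" and pV: "p \<in> V" and WV: "W \<subseteq> V"
    using Y p unfolding smooth_along_in_chart_def by auto
  have pS: "p \<in> points S" using p W openin_subset unfolding points_def by blast
  note pM = sub_points[OF pS] and pv = push_tangent[OF v pS]
  have yp: "Y p \<in> tangent_space M p" and zp: "Z p \<in> tangent_space M p"
    using Y Z p unfolding smooth_along_in_chart_def by auto
  have E: "?E a p \<in> tangent_space M p" and n: "?n a \<in> tangent_space M p" for a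
    using chart_vec_tangent[OF V pV] nabla_tangent[OF connection smooth_vf_chart_vec[OF V] pV pv] by auto
  have y: "smooth_near S p (?y a)" and z: "smooth_near S p (?z a)" for a
    using Y Z S.smooth_nearI p unfolding smooth_along_in_chart_def by blast+
  have G: "smooth_near S p (?G a b)" for a b
    using S.smooth_nearI[OF smooth_fun_metric_chart[OF V W WV] p] .
  have vG: "v (?G a b) = g p (?n a) (?E b p) + g p (?E a p) (?n b)" for a b
    using metric_compatible[OF smooth_vf_chart_vec[OF V] smooth_vf_chart_vec[OF V] pV pv]
      push_apply[OF smooth_nearI[OF metric_smooth[OF smooth_vf_chart_vec[OF V] smooth_vf_chart_vec[OF V]] pV], of v]
    by simp
  have Zx: "Z p = (\<Sum>b\<in>Basis. ?z b p *\<^sub>R ?E b p)" and Yx: "Y p = (\<Sum>b\<in>Basis. ?y b p *\<^sub>R ?E b p)"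
    using tangent_expand[OF V pV] yp zp by auto
  have gz: "g p u (Z p) = (\<Sum>b\<in>Basis. ?z b p * g p u (?E b p))" if "u \<in> tangent_space M p" for u
    by (subst Zx) (rule metric_sum_right[OF pM that E])
  have gy: "g p (Y p) u = (\<Sum>a\<in>Basis. ?y a p * g p (?E a p) u)" if "u \<in> tangent_space M p" for u
    by (subst Yx) (rule metric_sum_left[OF pM that E])
  have mixed: "v (\<lambda>q. ?y a q * (?z b q * ?G a b q)) = v (?y a) * (?z b p * ?G a b p)
      + ?y a p * (v (?z b) * ?G a b p + ?z b p * (g p (?n a) (?E b p) + g p (?E a p) (?n b)))" for a b
    using S.tangent_mult[OF v y S.smooth_near_mult[OF z G]] S.tangent_mult[OF v z G] vG by simp
  have near: "smooth_near S p (\<lambda>q. ?y a q * (?z b q * ?G a b q))" for a b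
    by (intro S.smooth_near_mult y z G)
  have inner: "smooth_near S p (\<lambda>q. \<Sum>b\<in>Basis. ?y a q * (?z b q * ?G a b q)) \<and>
      v (\<lambda>q. \<Sum>b\<in>Basis. ?y a q * (?z b q * ?G a b q)) = (\<Sum>b\<in>Basis. v (\<lambda>q. ?y a q * (?z b q * ?G a b q)))"
    for a by (rule S.tangent_sum[OF v pS near])
  have "v (\<lambda>q. g q (Y q) (Z q)) = v (\<lambda>q. \<Sum>a\<in>Basis. \<Sum>b\<in>Basis. ?y a q * (?z b q * ?G a b q))"
    by (rule S.tangent_cong[OF v W p]) (rule metric_along_expand[OF Y Z])
  also have "\<dots> = (\<Sum>a\<in>Basis. v (\<lambda>q. \<Sum>b\<in>Basis. ?y a q * (?z b q * ?G a b q)))"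
    by (rule S.tangent_sum[OF v pS, THEN conjunct2]) (rule inner[THEN conjunct1])
  also have "\<dots> = (\<Sum>a\<in>Basis. \<Sum>b\<in>Basis. v (\<lambda>q. ?y a q * (?z b q * ?G a b q)))"
    by (intro sum.cong refl inner[THEN conjunct2])
  \<comment> \<open>The terms are grouped by whether \<open>Y\<close> or \<open>Z\<close> is
    differentiated; the derivative of the Gram coefficients contributes one part to each
    group.\<close>
  also have "\<dots> = (\<Sum>a\<in>Basis. \<Sum>b\<in>Basis. v (?y a) * (?z b p * ?G a b p) + ?y a p * (?z b p * g p (?n a) (?E b p)))
      + (\<Sum>a\<in>Basis. \<Sum>b\<in>Basis. ?y a p * (v (?z b) * ?G a b p) + ?y a p * (?z b p * g p (?E a p) (?n b)))"
    unfolding mixed sum.distrib[symmetric] by (intro sum.cong refl) (simp add: algebra_simps)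
  also have "(\<Sum>a\<in>Basis. \<Sum>b\<in>Basis. v (?y a) * (?z b p * ?G a b p) + ?y a p * (?z b p * g p (?n a) (?E b p)))
      = g p (nabla_along V \<psi> p v Y) (Z p)"
  proof -
    have "g p (nabla_along V \<psi> p v Y) (Z p) = (\<Sum>a\<in>Basis. v (?y a) * g p (?E a p) (Z p)) + (\<Sum>a\<in>Basis. ?y a p * g p (?n a) (Z p))"
      unfolding nabla_along_def
      by (subst metric_add_left) (auto intro!: tangent_sum_mem tangent_scale_mem pM E n zp arg_cong2[where f = plus] metric_sum_left)
    then show ?thesis unfolding gz[OF E] gz[OF n] by (simp add: sum_distrib_left sum.distrib)
  qed
  also have "(\<Sum>a\<in>Basis. \<Sum>b\<in>Basis. ?y a p * (v (?z b) * ?G a b p) + ?y a p * (?z b p * g p (?E a p) (?n b)))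
      = g p (Y p) (nabla_along V \<psi> p v Z)"
  proof -
    have "g p (?E a p) (nabla_along V \<psi> p v Z) = (\<Sum>b\<in>Basis. v (?z b) * ?G a b p) + (\<Sum>b\<in>Basis. ?z b p * g p (?E a p) (?n b))" for a
      unfolding nabla_along_def
      by (subst metric_add_right) (auto intro!: tangent_sum_mem tangent_scale_mem pM E n zp arg_cong2[where f = plus] metric_sum_right)
    then show ?thesis unfolding gy[OF nabla_along_tangent[OF V pV pS v]]
      by (simp add: sum_distrib_left sum.distrib distrib_left)
  qed
  finally show ?thesis .
qed

lemma nabla_push_expand:
  assumes V: "(V, \<psi>) \<in> atlas M" "p \<in> V" and p: "p \<in> points S" and v: "v \<in> tangent_space S p"
    and Y: "smooth_vf M V Y"
  shows "nabla p (push M p v) Y = (\<Sum>a\<in>Basis. v (\<lambda>r. \<psi> r \<bullet> a) *\<^sub>R nabla p (chart_vec M V \<psi> p a) Y)"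
proof -
  have "push M p v = (\<Sum>a\<in>Basis. v (\<lambda>r. \<psi> r \<bullet> a) *\<^sub>R chart_vec M V \<psi> p a)"
    using tangent_expand[OF V push_tangent[OF v p]] by (simp add: push_coord[OF V])
  then show ?thesis
    using linear_map_on_sum[OF nabla_linear[OF connection Y V(2)] subspace_tangent_space[OF sub_points[OF p]]
        chart_vec_tangent[OF V]] by simp
qed

text \<open>By \<open>nabla_coordinate_sym\<close> the terms with derivatives of the frame cancel,
  and what remains are the coordinates of the bracket. The hypothesis \<open>br\<close> allows the
  bracket to be recovered from them.\<close>

lemma nabla_along_torsion_free:
  assumes V: "(V, \<psi>) \<in> atlas M" and W: "W \<subseteq> V" and X: "smooth_vf S W X" and Y: "smooth_vf S W Y" and p: "p \<in> W"
    and br: "lie_bracket S X Y p \<in> tangent_space S p"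
  shows "nabla_along V \<psi> p (X p) (\<lambda>q. push M q (Y q)) - nabla_along V \<psi> p (Y p) (\<lambda>q. push M q (X q))
    = push M p (lie_bracket S X Y p)"
proof -
  let ?E = "\<lambda>a q. chart_vec M V \<psi> q a" and ?c = "\<lambda>b r. \<psi> r \<bullet> b"
  let ?n = "\<lambda>a b. nabla p (?E a p) (?E b)"
  have pV: "p \<in> V" using p W by blast
  have pS: "p \<in> points S" using S.smooth_vf_points[OF X p] .
  have d: "v (\<lambda>q. push M q (Z q) (?c b)) = v (\<lambda>q. Z q (?c b))" if "v \<in> tangent_space S p" for v Z b
    by (rule S.tangent_cong[OF that S.smooth_vf_openin[OF X] p]) (use push_coord[OF V] W in auto)
  have Xt: "X p \<in> tangent_space S p" and Yt: "Y p \<in> tangent_space S p"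
    using S.smooth_vf_tangent[OF _ p] X Y by auto
  have al: "nabla_along V \<psi> p (X p) (\<lambda>q. push M q (Y q)) =
      (\<Sum>b\<in>Basis. X p (\<lambda>q. Y q (?c b)) *\<^sub>R ?E b p) + (\<Sum>b\<in>Basis. \<Sum>a\<in>Basis. (Y p (?c b) * X p (?c a)) *\<^sub>R ?n a b)"
    if Xt: "X p \<in> tangent_space S p" for X Y :: "'a \<Rightarrow> 'a tvec"
    unfolding nabla_along_def d[OF Xt] push_coord[OF V pV] nabla_push_expand[OF V pV pS Xt smooth_vf_chart_vec[OF V]]
      scaleR_sum_right scaleR_scaleR ..
  have "(\<Sum>b\<in>Basis. \<Sum>a\<in>Basis. (Y p (?c b) * X p (?c a)) *\<^sub>R ?n a b)
      = (\<Sum>a\<in>Basis. \<Sum>b\<in>Basis. (Y p (?c b) * X p (?c a)) *\<^sub>R ?n a b)" by (rule sum.swap)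
  also have "\<dots> = (\<Sum>b\<in>Basis. \<Sum>a\<in>Basis. (X p (?c b) * Y p (?c a)) *\<^sub>R ?n a b)"
    by (intro sum.cong refl) (simp only: nabla_coordinate_sym[OF V pV] mult.commute)
  finally have D: "(\<Sum>b\<in>Basis. \<Sum>a\<in>Basis. (Y p (?c b) * X p (?c a)) *\<^sub>R ?n a b)
      = (\<Sum>b\<in>Basis. \<Sum>a\<in>Basis. (X p (?c b) * Y p (?c a)) *\<^sub>R ?n a b)" .
  have "nabla_along V \<psi> p (X p) (\<lambda>q. push M q (Y q)) - nabla_along V \<psi> p (Y p) (\<lambda>q. push M q (X q))
      = (\<Sum>b\<in>Basis. X p (\<lambda>q. Y q (?c b)) *\<^sub>R ?E b p) - (\<Sum>b\<in>Basis. Y p (\<lambda>q. X q (?c b)) *\<^sub>R ?E b p)"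
    unfolding al[of X, OF Xt] al[of Y, OF Yt] D by (rule add_diff_cancel_right)
  also have "\<dots> = (\<Sum>b\<in>Basis. (X p (\<lambda>q. Y q (?c b)) - Y p (\<lambda>q. X q (?c b))) *\<^sub>R ?E b p)"
    by (simp only: sum_subtractf scaleR_diff_left)
  also have "\<dots> = (\<Sum>b\<in>Basis. push M p (lie_bracket S X Y p) (?c b) *\<^sub>R ?E b p)"
  proof (intro sum.cong refl)
    fix b :: 'e
    have "smooth_near S p (?c b)" by (rule smooth_near_restrict[OF smooth_nearI[OF smooth_fun_coord[OF V] pV] pS])
    then have "lie_bracket S X Y p (?c b) = X p (\<lambda>q. Y q (?c b)) - Y p (\<lambda>q. X q (?c b))"
      by (simp add: lie_bracket_def)
    then show "(X p (\<lambda>q. Y q (?c b)) - Y p (\<lambda>q. X q (?c b))) *\<^sub>R ?E b p = push M p (lie_bracket S X Y p) (?c b) *\<^sub>R ?E b p"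
      by (simp only: push_coord[OF V pV])
  qed
  also have "\<dots> = push M p (lie_bracket S X Y p)"
    using tangent_expand[OF V pV push_tangent[OF br pS]] by simp
  finally show ?thesis .
qed

text \<open>The uniqueness argument of the conformal change again: the tangential part of
  \<open>nabla_along\<close> is torsion-free and compatible with the induced metric, so
  \<open>symmetric_skew_zero\<close> kills its difference from \<open>nabla_S\<close>.\<close>

lemma gauss_formula:
  assumes LS: "levi_civita S (induced_metric M g) nabla_S"
    and V: "(V, \<psi>) \<in> atlas M" and W: "W \<subseteq> V"
    and XYZ: "smooth_vf S W X" "smooth_vf S W Y" "smooth_vf S W Z" and p: "p \<in> W"
  shows "induced_metric M g p (nabla_S p (X p) Y) (Z p)
    = g p (nabla_along V \<psi> p (X p) (\<lambda>q. push M q (Y q))) (push M p (Z p))"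
proof -
  interpret SL: levi_civita_mfd S mS "induced_metric M g" nabla_S
    by unfold_locales (use riemannian_induced LS in auto)
  let ?P = "\<lambda>Y q. push M q (Y q)"
  let ?B = "\<lambda>X Y Z. induced_metric M g p (nabla_S p (X p) Y) (Z p) - g p (nabla_along V \<psi> p (X p) (?P Y)) (push M p (Z p))"
  have pS: "p \<in> points S" using S.smooth_vf_points[OF XYZ(1) p] .
  have pV: "p \<in> V" using p W by blast
  note pM = sub_points[OF pS]
  have "?B X Y Z = 0"
  proof (rule symmetric_skew_zero[of "{X. smooth_vf S W X}" ?B])
    fix X Y Z assume "X \<in> {X. smooth_vf S W X}" "Y \<in> {X. smooth_vf S W X}" "Z \<in> {X. smooth_vf S W X}"
    then have XYZ: "smooth_vf S W X" "smooth_vf S W Y" "smooth_vf S W Z" by auto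
    note t = XYZ[THEN S.smooth_vf_tangent, OF p]
    note n = S.nabla_tangent[OF SL.connection _ p]
    note al = nabla_along_tangent[OF V pV pS]
    note pt = push_tangent[OF _ pS]
    have br: "nabla_S p (X p) Y - nabla_S p (Y p) X = lie_bracket S X Y p"
      by (rule SL.torsion_free[OF XYZ(1,2) p])
    have "induced_metric M g p (nabla_S p (X p) Y - nabla_S p (Y p) X) (Z p)
        = g p (nabla_along V \<psi> p (X p) (?P Y) - nabla_along V \<psi> p (Y p) (?P X)) (push M p (Z p))"
      unfolding br nabla_along_torsion_free[OF V W XYZ(1,2) p SL.lie_bracket_tangent[OF XYZ(1,2) p]]
        induced_metric_def ..
    then show "?B X Y Z = ?B Y X Z"
      using SL.metric_diff_left[OF pS n[OF XYZ(2) t(1)] n[OF XYZ(1) t(2)] t(3)]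
        metric_diff_left[OF pM al[OF t(1)] al[OF t(2)] pt[OF t(3)], of "?P Y" "?P X"] by simp
    have "induced_metric M g p (nabla_S p (X p) Y) (Z p) + induced_metric M g p (Y p) (nabla_S p (X p) Z)
        = X p (\<lambda>q. g q (?P Y q) (?P Z q))"
      using SL.metric_compatible[OF XYZ(2,3) p t(1)] by (simp add: induced_metric_def)
    also have "\<dots> = g p (nabla_along V \<psi> p (X p) (?P Y)) (?P Z p) + g p (?P Y p) (nabla_along V \<psi> p (X p) (?P Z))"
      by (rule nabla_along_metric[OF smooth_along_in_chart_push[OF V XYZ(2) W] smooth_along_in_chart_push[OF V XYZ(3) W] p t(1)])
    finally show "?B X Y Z = - ?B X Z Y"
      using SL.metric_sym[OF pS t(2) n[OF XYZ(3) t(1)]] metric_sym[OF pM pt[OF t(2)] al[OF t(1)], of "?P Z"]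
      by simp
  qed (use XYZ in auto)
  then show ?thesis by simp
qed

end

section \<open>CR-hypersurfaces of conformal Kenmotsu manifolds\<close>

text \<open>Both sides are values of the Hessian of \<open>f\<close>: metric compatibility turns
  them into X(Yf) - (\<nabla>_X Y)f, which is symmetric by torsion-freeness. Along the hypersurface
  this becomes the symmetry of the shape operator.\<close>

lemma (in levi_civita_mfd) hessian_symmetric:
  assumes f: "smooth_fun M W f" and L: "smooth_vf M W L"
    and Lf: "\<And>q u. q \<in> W \<Longrightarrow> u \<in> tangent_space M q \<Longrightarrow> g q (L q) u = u f"
    and p: "p \<in> W" and v: "v \<in> tangent_space M p" and w: "w \<in> tangent_space M p"
  shows "g p (nabla p v L) w = g p (nabla p w L) v"
proof -
  have pM: "p \<in> points M" using smooth_vf_points[OF L p] .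
  obtain U \<kappa> where U: "(U, \<kappa>) \<in> atlas M" "p \<in> U" using chart_at[OF pM] .
  obtain X0 Y0 where X0: "smooth_vf M U X0" "X0 p = v" and Y0: "smooth_vf M U Y0" "Y0 p = w"
    using tangent_extend[OF U v] tangent_extend[OF U w] by metis
  let ?W = "U \<inter> W"
  have W: "openin (topo M) ?W" using openin_Int_chart[OF U(1) smooth_vf_openin[OF L]] .
  have pW: "p \<in> ?W" using p U by blast
  have f': "smooth_fun M ?W f" by (rule smooth_fun_subset[OF f W]) simp
  have L': "smooth_vf M ?W L" by (rule smooth_vf_subset[OF L W]) simp
  have X: "smooth_vf M ?W X0" and Y: "smooth_vf M ?W Y0"
    using smooth_vf_subset[OF X0(1) W] smooth_vf_subset[OF Y0(1) W] by auto
  have hess: "g p (nabla p (X p) L) (Y p) = X p (\<lambda>q. Y q f) - nabla p (X p) Y f"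
    if X: "smooth_vf M ?W X" and Y: "smooth_vf M ?W Y" for X Y
  proof -
    have Xp: "X p \<in> tangent_space M p" using smooth_vf_tangent[OF X pW] .
    have "X p (\<lambda>q. Y q f) = X p (\<lambda>q. g q (L q) (Y q))"
      by (rule tangent_cong[OF Xp W pW]) (use Lf smooth_vf_tangent[OF Y] in auto)
    then show ?thesis
      using metric_compatible[OF L' Y pW Xp] Lf[OF p nabla_tangent[OF connection Y pW Xp]] by simp
  qed
  have "(nabla p (X0 p) Y0 - nabla p (Y0 p) X0) f = X0 p (\<lambda>q. Y0 q f) - Y0 p (\<lambda>q. X0 q f)"
    unfolding torsion_free[OF X Y pW] by (rule lie_bracket_apply[OF smooth_nearI[OF f' pW]])
  then show ?thesis using hess[OF X Y] hess[OF Y X] X0(2) Y0(2) by simp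
qed

theorem theorem6p1:
  fixes n :: nat
    and M :: "('a, 'e::euclidean_space) mfd"
    and S :: "('a, 'h::euclidean_space) mfd"
    and \<phi> :: "'a \<Rightarrow> 'a tvec \<Rightarrow> 'a tvec" and \<xi> :: "'a \<Rightarrow> 'a tvec" and \<eta> :: "'a \<Rightarrow> 'a tvec \<Rightarrow> real"
    and g :: "'a \<Rightarrow> 'a tvec \<Rightarrow> 'a tvec \<Rightarrow> real"
    and f :: "'a \<Rightarrow> real" and c :: real
    and nabla nabla_S :: "'a connection"
    and D D_perp :: "'a \<Rightarrow> 'a tvec set"
    and N U L :: "'a \<Rightarrow> 'a tvec"
    and A :: "'a \<Rightarrow> 'a tvec \<Rightarrow> 'a tvec"
  assumes M: "conformal_kenmotsu_space_form n M \<phi> \<xi> \<eta> g f c"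
    and LC: "levi_civita M g nabla"
    and S: "cr_hypersurface n M \<phi> \<xi> g S D D_perp"
    and N: "unit_normal_field M g S N"
    and U: "\<And>p. p \<in> points S \<Longrightarrow> U p = - \<phi> p (N p)"
    and D_perp: "\<And>p. p \<in> points S \<Longrightarrow> push M p ` D_perp p = span {U p, \<xi> p}"
    and D: "\<And>p. p \<in> points S \<Longrightarrow>
      D p = {v \<in> tangent_space S p. \<forall>w\<in>D_perp p. induced_metric M g p v w = 0}"
    and LC_S: "levi_civita S (induced_metric M g) nabla_S"
    and A: "shape_operator M nabla S N A"
    and rec: "recurrent S nabla_S A"
    and Lee: "lee_vector_field M g f L"
    and Lee_N: "\<And>p. p \<in> points S \<Longrightarrow> L p = N p"
  shows "totally_umbilic S A"
proof -
  let ?g' = "induced_metric M g"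
  have acm: "almost_contact_metric n M \<phi> \<xi> \<eta> g" and f: "smooth_fun M (points M) f"
    using M unfolding conformal_kenmotsu_space_form_def by blast+
  obtain nabla' where K: "kenmotsu n M \<phi> (\<lambda>p. exp (- f p / 2) *\<^sub>R \<xi> p) (\<lambda>p v. exp (f p / 2) * \<eta> p v)
      (\<lambda>p v w. exp (f p) * g p v w) nabla'"
    using M unfolding conformal_kenmotsu_space_form_def Let_def by blast
  have emb: "embedded_submanifold (2 * n) S M" using S unfolding cr_hypersurface_def by blast
  interpret levi_civita_submfd M "2 * n + 1" S "2 * n" g nabla
    by unfold_locales (use acm emb LC in \<open>auto simp: almost_contact_metric_def embedded_submanifold_def\<close>)
  interpret SL: levi_civita_mfd S "2 * n" ?g' nabla_S
    by unfold_locales (use riemannian_induced LC_S in auto)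
  obtain \<alpha> where \<alpha>: "\<And>W Y p v. smooth_vf S W Y \<Longrightarrow> p \<in> W \<Longrightarrow> v \<in> tangent_space S p \<Longrightarrow>
      cov_deriv_tensor11 nabla_S A p v Y = \<alpha> p v *\<^sub>R A p (Y p)"
    using rec unfolding recurrent_def by blast
  have \<xi>: "smooth_vf M (points M) \<xi>" using acm unfolding almost_contact_metric_def by blast
  have \<eta>: "\<eta> q u = g q u (\<xi> q)" and \<eta>\<xi>: "\<eta> q (\<xi> q) = 1"
    if "q \<in> points M" "u \<in> tangent_space M q" for q u
    using acm that unfolding almost_contact_metric_def by blast+
  have Lt: "L q \<in> tangent_space M q" and Lf: "u \<in> tangent_space M q \<Longrightarrow> g q (L q) u = u f"
    if "q \<in> points M" for q u
    using Lee that unfolding lee_vector_field_def lee_form_def by blast+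
  have NN: "g q (L q) (L q) = 1" and LS: "u \<in> tangent_space S q \<Longrightarrow> g q (L q) (push M q u) = 0"
    if "q \<in> points S" for q u
    using N that Lee_N[OF that] unfolding unit_normal_field_def normal_space_def by auto
  \<comment> \<open>\<open>\<xi>S\<close> is the preimage of \<xi> under \<open>push\<close>, so
    that the connection and the shape operator of \<open>S\<close> can act on it. It is chosen point
    by point and gets its smoothness from the metric in \<open>\<xi>S_smooth\<close>.\<close>
  define \<xi>S where "\<xi>S q = (SOME u. u \<in> tangent_space S q \<and> push M q u = \<xi> q)" for q
  have \<xi>S: "\<xi>S q \<in> tangent_space S q \<and> push M q (\<xi>S q) = \<xi> q" if "q \<in> points S" for q
  proof -
    have "\<xi> q \<in> push M q ` tangent_space S q"
      by (rule S[unfolded cr_hypersurface_def, THEN conjunct2, THEN conjunct2, THEN conjunct2, THEN bspec,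
            OF that, THEN conjunct1])
    then have "\<exists>u. u \<in> tangent_space S q \<and> push M q u = \<xi> q" by force
    then show ?thesis unfolding \<xi>S_def by (rule someI_ex)
  qed
  note \<xi>S = \<xi>S[THEN conjunct1] \<xi>S[THEN conjunct2]
  have L\<xi>: "g q (L q) (\<xi> q) = 0" if "q \<in> points S" for q
    using LS[OF that \<xi>S(1)[OF that]] \<xi>S(2)[OF that] by simp
  \<comment> \<open>The term with \<xi>(f) drops out because \<open>L\<close>, the gradient of
    \<open>f\<close>, is orthogonal to \<xi> along \<open>S\<close>.\<close>
  have nabla_\<xi>: "g q (nabla q v \<xi>) w = exp (f q / 2) * (g q v w - \<eta> q v * \<eta> q w) + w f * \<eta> q v / 2"
    if q: "q \<in> points S" and v: "v \<in> tangent_space M q" and w: "w \<in> tangent_space M q" for q v w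
    using conformal_kenmotsu_nabla_xi[OF K acm refl f sub_points[OF q] v w]
      L\<xi>[OF q] Lf[OF sub_points[OF q] smooth_vf_tangent[OF \<xi> sub_points[OF q]]] by simp
  have "A p v = (1 / 2) *\<^sub>R v" if p: "p \<in> points S" and v: "v \<in> tangent_space S p" for p v
  proof -
    note pM = sub_points[OF p]
    obtain V \<psi> where V: "(V, \<psi>) \<in> atlas M" "p \<in> V" using chart_at[OF pM] .
    obtain U \<kappa> where U: "(U, \<kappa>) \<in> atlas S" "p \<in> U" using S.chart_at[OF p] .
    have VM: "V \<subseteq> points M" using chart_subset[OF V(1)] .
    \<comment> \<open>\<open>lee_vector_field\<close> describes \<open>L\<close> pointwise; its
      inner product with a smooth field \<open>Z\<close> is the derivative of \<open>f\<close> along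
      \<open>Z\<close>, hence smooth.\<close>
    have L: "smooth_vf M V L"
    proof (rule smooth_vf_if_metric_smooth_chart[OF V(1) chart_openin[OF V(1)] order_refl])
      show "L q \<in> tangent_space M q" if "q \<in> V" for q using Lt VM that by blast
      show "smooth_fun M V (\<lambda>q. g q (L q) (Z q))" if Z: "smooth_vf M V Z" for Z
      proof (rule smooth_fun_cong)
        show "smooth_fun M V (\<lambda>q. Z q f)"
          by (rule smooth_vf_fun[OF Z smooth_fun_subset[OF f chart_openin[OF V(1)] VM] order_refl])
        show "Z q f = g q (L q) (Z q)" if "q \<in> V" for q
          using Lf[of q "Z q"] smooth_vf_tangent[OF Z that] VM that by auto
      qed
    qed
    have \<xi>V: "smooth_vf M V \<xi>" by (rule smooth_vf_subset[OF \<xi> chart_openin[OF V(1)] VM])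
    have fV: "smooth_fun M V f" by (rule smooth_fun_subset[OF f chart_openin[OF V(1)] VM])
    have At: "A q v \<in> tangent_space S q" if "q \<in> points S" "v \<in> tangent_space S q" for q v
      using A that unfolding shape_operator_def by blast
    \<comment> \<open>\<open>L\<close> serves as the local extension of \<open>N\<close> that
      \<open>shape_operator\<close> asks for.\<close>
    have Apush: "push M q (A q v) = - nabla q (push M q v) L"
      if "q \<in> V" "q \<in> points S" "v \<in> tangent_space S q" for q v
      using A that L Lee_N unfolding shape_operator_def by blast
    have Ag: "?g' q (A q v) w = - g q (nabla q (push M q v) L) (push M q w)"
      if q: "q \<in> V" "q \<in> points S" and v: "v \<in> tangent_space S q" and w: "w \<in> tangent_space S q" for q v w
      unfolding induced_metric_def Apush[OF q v]
      by (rule metric_minus_left[OF sub_points[OF q(2)]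
            nabla_tangent[OF connection L q(1) push_tangent[OF v q(2)]] push_tangent[OF w q(2)]])
    have A_sym: "?g' q (A q v) w = ?g' q (A q w) v"
      if q: "q \<in> V" "q \<in> points S" and v: "v \<in> tangent_space S q" and w: "w \<in> tangent_space S q" for q v w
      unfolding Ag[OF q v w] Ag[OF q w v]
      using hessian_symmetric[OF fV L _ q(1) push_tangent[OF v q(2)] push_tangent[OF w q(2)]] Lf VM by auto
    have \<xi>S_metric: "?g' q u (\<xi>S q) = \<eta> q (push M q u)" if q: "q \<in> points S" and u: "u \<in> tangent_space S q" for q u
      using \<eta>[OF sub_points[OF q] push_tangent[OF u q]] \<xi>S(2)[OF q] by (simp add: induced_metric_def)
    have A_\<xi>S: "?g' q (A q u) (\<xi>S q) = \<eta> q (push M q u) / 2"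
      if q: "q \<in> V" "q \<in> points S" and u: "u \<in> tangent_space S q" for q u
    proof -
      note pu = push_tangent[OF u q(2)] and qM = sub_points[OF q(2)]
      have near: "smooth_near M q (\<lambda>r. g r (L r) (\<xi> r))" using smooth_nearI[OF metric_smooth[OF L \<xi>V] q(1)] .
      \<comment> \<open>\<open>L\<close> and \<xi> are known to be orthogonal along \<open>S\<close>
        only. The derivative therefore passes to \<open>u\<close>, which acts on functions on
        \<open>S\<close>, before the function is replaced by 0.\<close>
      have "push M q u (\<lambda>r. g r (L r) (\<xi> r)) = u (\<lambda>r. g r (L r) (\<xi> r))" by (rule push_apply[OF near])
      also have "\<dots> = u (\<lambda>r. 0)"
        by (rule S.tangent_cong[OF u sub_openin_chart[OF V(1)]]) (use q L\<xi> in auto)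
      also have "\<dots> = 0" by (rule S.tangent_const[OF u q(2)])
      finally have "g q (nabla q (push M q u) L) (\<xi> q) = - g q (L q) (nabla q (push M q u) \<xi>)"
        using metric_compatible[OF L \<xi>V q(1) pu] by simp
      then have "?g' q (A q u) (\<xi>S q) = g q (nabla q (push M q u) \<xi>) (L q)"
        using Ag[OF q u \<xi>S(1)[OF q(2)]] \<xi>S(2)[OF q(2)]
          metric_sym[OF qM Lt[OF qM] nabla_tangent[OF connection \<xi>V q(1) pu]] by simp
      also have "\<dots> = exp (f q / 2) * (g q (push M q u) (L q) - \<eta> q (push M q u) * \<eta> q (L q)) + L q f * \<eta> q (push M q u) / 2"
        by (rule nabla_\<xi>[OF q(2) pu Lt[OF qM]])
      finally have eq: "?g' q (A q u) (\<xi>S q) = exp (f q / 2) * (g q (push M q u) (L q)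
          - \<eta> q (push M q u) * \<eta> q (L q)) + L q f * \<eta> q (push M q u) / 2" .
      have "g q (push M q u) (L q) = 0" using LS[OF q(2) u] metric_sym[OF qM Lt[OF qM] pu] by simp
      moreover have "\<eta> q (L q) = 0" using \<eta>[OF qM Lt[OF qM]] L\<xi>[OF q(2)] by simp
      \<comment> \<open>The unit length of \<open>N\<close> leaves exactly the coefficient 1/2 of
        the gradient term, the origin of the eigenvalue.\<close>
      moreover have "L q f = 1" using Lf[OF qM Lt[OF qM]] NN[OF q(2)] by simp
      ultimately show ?thesis using eq
        by (simp only: mult_zero_right diff_zero add_0 mult_1)
    qed
    \<comment> \<open>Symmetry moves \<open>A\<close> from \<open>\<xi>S\<close> to an arbitrary
      tangent vector, where \<open>A_\<xi>S\<close> evaluates the pairing.\<close>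
    have A_eigen: "A q (\<xi>S q) = (1 / 2) *\<^sub>R \<xi>S q" if q: "q \<in> V" "q \<in> points S" for q
    proof (rule SL.metric_nondegenerate[OF q(2)])
      note x = \<xi>S(1)[OF q(2)]
      show "A q (\<xi>S q) \<in> tangent_space S q" using At[OF q(2) x] .
      show "(1 / 2) *\<^sub>R \<xi>S q \<in> tangent_space S q" using SL.tangent_scale_mem[OF q(2) x] .
      show "?g' q (A q (\<xi>S q)) u = ?g' q ((1 / 2) *\<^sub>R \<xi>S q) u" if u: "u \<in> tangent_space S q" for u
        unfolding A_sym[OF q x u] A_\<xi>S[OF q u] SL.metric_scale_left[OF q(2) x u]
          SL.metric_sym[OF q(2) x u] \<xi>S_metric[OF q(2) u] by simp
    qed
    let ?W = "U \<inter> (V \<inter> points S)"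
    have W: "openin (topo S) ?W" using S.openin_Int_chart[OF U(1) sub_openin_chart[OF V(1)]] .
    have pW: "p \<in> ?W" using U V p by blast
    have \<xi>S_smooth: "smooth_vf S ?W \<xi>S"
    proof (rule SL.smooth_vf_if_metric_smooth_chart[OF U(1) W])
      show "\<xi>S q \<in> tangent_space S q" if "q \<in> ?W" for q using \<xi>S that by blast
      show "smooth_fun S ?W (\<lambda>q. ?g' q (\<xi>S q) (Z q))" if Z: "smooth_vf S ?W Z" for Z
      proof (rule S.smooth_fun_cong)
        \<comment> \<open>The pairing sees only \<xi>, a smooth field of \<open>M\<close>, so its
          smoothness does not depend on the choice made in \<open>\<xi>S\<close>.\<close>
        show "smooth_fun S ?W (\<lambda>q. g q (\<xi> q) (push M q (Z q)))"
          by (rule smooth_fun_metric_along[OF smooth_along_in_chart_restrict[OF V(1) \<xi>V W]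
                smooth_along_in_chart_push[OF V(1) Z]]) auto
        show "g q (\<xi> q) (push M q (Z q)) = ?g' q (\<xi>S q) (Z q)" if "q \<in> ?W" for q
          using \<xi>S that by (auto simp: induced_metric_def)
      qed
    qed auto
    have nabla_S_\<xi>S: "?g' p (nabla_S p u \<xi>S) w
        = exp (f p / 2) * (?g' p u w - \<eta> p (push M p u) * \<eta> p (push M p w))"
      if u: "u \<in> tangent_space S p" and w: "w \<in> tangent_space S p" for u w
    proof -
      obtain X0 Z0 where X0: "smooth_vf S U X0" "X0 p = u" and Z0: "smooth_vf S U Z0" "Z0 p = w"
        using S.tangent_extend[OF U u] S.tangent_extend[OF U w] by metis
      have X: "smooth_vf S ?W X0" and Z: "smooth_vf S ?W Z0"
        using S.smooth_vf_subset[OF X0(1) W] S.smooth_vf_subset[OF Z0(1) W] by auto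
      have "?g' p (nabla_S p u \<xi>S) w = g p (nabla_along V \<psi> p u (\<lambda>q. push M q (\<xi>S q))) (push M p w)"
        using gauss_formula[OF LC_S V(1) _ X \<xi>S_smooth Z pW] X0(2) Z0(2) by auto
      also have "nabla_along V \<psi> p u (\<lambda>q. push M q (\<xi>S q)) = nabla_along V \<psi> p u \<xi>"
        by (rule nabla_along_cong[OF u W pW]) (use \<xi>S in auto)
      also have "\<dots> = nabla p (push M p u) \<xi>" by (rule nabla_along_restrict[OF V \<xi>V p u])
      also have "g p \<dots> (push M p w) = exp (f p / 2) * (g p (push M p u) (push M p w)
          - \<eta> p (push M p u) * \<eta> p (push M p w)) + push M p w f * \<eta> p (push M p u) / 2"
        by (rule nabla_\<xi>[OF p push_tangent[OF u p] push_tangent[OF w p]])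
      finally have eq: "?g' p (nabla_S p u \<xi>S) w = exp (f p / 2) * (g p (push M p u) (push M p w)
          - \<eta> p (push M p u) * \<eta> p (push M p w)) + push M p w f * \<eta> p (push M p u) / 2" .
      \<comment> \<open>The gradient term has no tangential part: \<open>push M p w\<close> is
        tangent to \<open>S\<close>, and grad f is \<open>N\<close> there.\<close>
      have "push M p w f = 0" using Lf[OF pM push_tangent[OF w p]] LS[OF p w] by simp
      with eq show ?thesis
        unfolding induced_metric_def by (simp only: mult_zero_left div_0 add_0_right)
    qed
    \<comment> \<open>Recurrence applied to \<open>\<xi>S\<close> and paired with \<open>w\<close>.
      Symmetry moves \<open>A\<close> from the derivative of \<open>\<xi>S\<close> to
      \<open>w\<close>, so that \<open>nabla_S_\<xi>S\<close> evaluates both terms on the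
      left.\<close>
    have key: "exp (f p / 2) * (?g' p u w / 2 - ?g' p u (A p w)) = \<alpha> p u * \<eta> p (push M p w) / 2"
      if u: "u \<in> tangent_space S p" and w: "w \<in> tangent_space S p" for u w
    proof -
      note x = \<xi>S(1)[OF p] and D = S.nabla_tangent[OF SL.connection \<xi>S_smooth pW u]
      \<comment> \<open>The eigenvalue is constant on \<open>?W\<close>, so differentiating the
        eigenvector equation produces no derivative of it.\<close>
      have "nabla_S p u (\<lambda>q. (1 / 2) *\<^sub>R \<xi>S q) = nabla_S p u (\<lambda>q. A q (\<xi>S q))"
        by (rule S.nabla_cong[OF SL.connection S.smooth_vf_scale[OF S.smooth_fun_const[OF W] \<xi>S_smooth] _ pW u])
           (use A_eigen in auto)
      then have "nabla_S p u (\<lambda>q. A q (\<xi>S q)) = (1 / 2) *\<^sub>R nabla_S p u \<xi>S"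
        using S.nabla_scale[OF SL.connection \<xi>S_smooth pW u] by simp
      then have "(1 / 2) *\<^sub>R nabla_S p u \<xi>S - A p (nabla_S p u \<xi>S) = \<alpha> p u *\<^sub>R A p (\<xi>S p)"
        using \<alpha>[OF \<xi>S_smooth pW u] by (simp add: cov_deriv_tensor11_def)
      then have "?g' p ((1 / 2) *\<^sub>R nabla_S p u \<xi>S - A p (nabla_S p u \<xi>S)) w = ?g' p (\<alpha> p u *\<^sub>R A p (\<xi>S p)) w"
        by (simp only:)
      then have "?g' p (nabla_S p u \<xi>S) w / 2 - ?g' p (nabla_S p u \<xi>S) (A p w) = \<alpha> p u * ?g' p (A p (\<xi>S p)) w"
        using SL.metric_diff_left[OF p SL.tangent_scale_mem[OF p D, of "1 / 2"] At[OF p D] w]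
          SL.metric_scale_left[OF p D w, of "1 / 2"] SL.metric_scale_left[OF p At[OF p x] w, of "\<alpha> p u"]
          A_sym[OF V(2) p D w] SL.metric_sym[OF p D At[OF p w]] by simp
      also have "?g' p (A p (\<xi>S p)) w = \<eta> p (push M p w) / 2"
        using A_sym[OF V(2) p x w] A_\<xi>S[OF V(2) p w] by simp
      finally have eq: "?g' p (nabla_S p u \<xi>S) w / 2 - ?g' p (nabla_S p u \<xi>S) (A p w) = \<alpha> p u * (\<eta> p (push M p w) / 2)" .
      \<comment> \<open>With this value the two terms in \<eta>(u)\<eta>(w) cancel, which leaves
        only metric terms on the left of \<open>key\<close>.\<close>
      have half: "\<eta> p (push M p (A p w)) = \<eta> p (push M p w) / 2"
        using \<xi>S_metric[OF p At[OF p w]] A_\<xi>S[OF V(2) p w] by simp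
      show ?thesis
        using eq unfolding nabla_S_\<xi>S[OF u w] nabla_S_\<xi>S[OF u At[OF p w]] half by argo
    qed
    have \<eta>1: "\<eta> p (push M p (\<xi>S p)) = 1"
      using \<eta>\<xi>[OF pM push_tangent[OF \<xi>S(1)[OF p] p]] \<xi>S(2)[OF p] by simp
    \<comment> \<open>For \<open>w\<close> equal to \<open>\<xi>S p\<close> the left side of
      \<open>key\<close> is 0 by the eigenvector equation, and the right side is half of
      \<open>\<alpha> p u\<close>.\<close>
    have \<alpha>0: "\<alpha> p u = 0" if u: "u \<in> tangent_space S p" for u
      using key[OF u \<xi>S(1)[OF p]] \<eta>1 A_eigen[OF V(2) p] SL.metric_scale_right[OF p u \<xi>S(1)[OF p], of "1 / 2"] by simp
    show ?thesis
    proof (rule SL.metric_nondegenerate[OF p At[OF p v] SL.tangent_scale_mem[OF p v]])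
      fix u assume u: "u \<in> tangent_space S p"
      have "?g' p u v / 2 = ?g' p u (A p v)" using key[OF u v] \<alpha>0[OF u] by simp
      then show "?g' p (A p v) u = ?g' p ((1 / 2) *\<^sub>R v) u"
        using SL.metric_sym[OF p u v] SL.metric_sym[OF p u At[OF p v]] SL.metric_scale_left[OF p v u, of "1 / 2"] by simp
    qed
  qed
  then show ?thesis unfolding totally_umbilic_def by (intro exI[of _ "\<lambda>p. 1 / 2"]) blast
qed

end
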